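(* Let $\Omega=\{(x_1,x_2)\in\mathbb{R}^2:x_1^2+x_2^2\le1\}$ and $M>0$. Let $v:\mathbb{R}\to\mathbb{R}$ be a convex function with $|p|\le v(p)\le|p|+M$ for all $p\in\mathbb{R}$ and $v(0)>0$, and let $u=\delta_\Omega\wedge v^*$ (so that $\operatorname{dom}u=\Omega$). Then $$\int_\Omega\frac{1}{1+|u'(x)|^2}\,dx=\int_{p_0^-}^{p_0^+}\left[\frac{2\sqrt{v^2-p^2}\,(v')^2}{(1+v^2)^2}-\frac{pv'-v}{v(1+v^2)\sqrt{v^2-p^2}}\right]dp,$$ where $p_0^-=\inf\{p:v(p)>-p\}$ and $p_0^+=\sup\{p:v(p)>p\}$ (possibly infinite).
   Context: $\delta_\Omega$ is the indicator function: $\delta_\Omega(x)=0$ for $x\in\Omega$, $+\infty$ otherwise. $v^*$ is the Legendre–Young–Fenchel conjugate $v^*(x_1)=\sup_{p}(px_1-v(p))$, regarded as a function on $\mathbb{R}^2$ equal to $v^*(x_1)$ at $(x_1,0)$ and to $+\infty$ at $(x_1,x_2)$ with $x_2\ne0$. For convex functions, $a\wedge b$ denotes the convex hull $\mathrm{conv}(a,b)$ of the two functions (the function whose epigraph is the convex hull of the union of their epigraphs); equivalently $u^*(p_1,p_2)=\max\{\sqrt{p_1^2+p_2^2},\,v(p_1)\}$. The derivatives $u'$ and $v'$ of convex functions exist almost everywhere. *)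

theory Defs
  imports "HOL-Analysis.Analysis"
begin

text \<open>
  Extended-valued functions are maps into \<^typ>\<open>ereal\<close>; the plane is \<^typ>\<open>real \<times> real\<close>, whose
  library norm is Euclidean.
\<close>

definition indicator_fun :: "'a set \<Rightarrow> 'a \<Rightarrow> ereal"
  where "indicator_fun S x = (if x \<in> S then 0 else \<infinity>)"

definition conjugate_fun :: "(real \<Rightarrow> real) \<Rightarrow> real \<Rightarrow> ereal"
  where "conjugate_fun v y = (SUP p. ereal (p * y - v p))"

definition extend_to_plane :: "(real \<Rightarrow> ereal) \<Rightarrow> real \<times> real \<Rightarrow> ereal"
  where "extend_to_plane g x = (if snd x = 0 then g (fst x) else \<infinity>)"

definition eff_dom :: "('a \<Rightarrow> ereal) \<Rightarrow> 'a set"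
  where "eff_dom f = {x. f x < \<infinity>}"

definition epi :: "('a \<Rightarrow> ereal) \<Rightarrow> ('a \<times> real) set"
  where "epi f = {(x, t). f x \<le> ereal t}"

text \<open>
  In general the convex hull of a union of epigraphs need not contain its lower boundary, hence the
  infimum; whenever the hull is itself the epigraph of a function, \<open>conv_fun f g\<close> is that function.
\<close>

definition conv_fun :: "('a::real_vector \<Rightarrow> ereal) \<Rightarrow> ('a \<Rightarrow> ereal) \<Rightarrow> 'a \<Rightarrow> ereal"
  where "conv_fun f g x = (INF t \<in> {t. (x, t) \<in> convex hull (epi f \<union> epi g)}. ereal t)"

text \<open>
  Like \<^const>\<open>deriv\<close>, this is a fixed unspecified value at every point of non-differentiability.
\<close>

definition gradient :: "('a::real_inner \<Rightarrow> real) \<Rightarrow> 'a \<Rightarrow> 'a"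
  where "gradient f x = (SOME D. GDERIV f x :> D)"

end

theory Submission
  imports Defs
begin

text \<open>
  The graph of \<open>u\<close> is ruled: through almost every point of the disc passes a chord from a point
  \<open>(m, 0)\<close>, where \<open>m\<close> is a subgradient of \<open>v\<close> at some \<open>p\<close>, to the point \<open>(p, \<plusminus>q) / v p\<close> of the unit
  circle, where \<open>q = sqrt ((v p)\<^sup>2 - p\<^sup>2)\<close>. Along this chord \<open>u\<close> is affine with gradient \<open>(p, \<plusminus>q)\<close>, of
  norm \<open>v p\<close>, so the left-hand side is the integral of \<open>1 / (1 + (v p)\<^sup>2)\<close> against the area swept by
  the chords as \<open>p\<close> grows. The region to the left of the chords of parameter \<open>p\<close> has area
  \<open>pi - arccos (p / v p) + v' p * q / v p\<close>. Writing \<open>1 / (1 + (v p)\<^sup>2)\<close> as the integral of its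
  derivative and exchanging integrals, only the area itself and not its (measure-valued) derivative
  is needed; integrating the sector part \<open>pi - arccos (p / v p)\<close> by parts gives the right-hand side.
\<close>

subsection \<open>Right derivatives and convex functions\<close>

text \<open>The obstacle is that \<open>v\<close> is only convex. At a kink one \<open>p\<close> has
  a whole interval of subgradients; their chords fill a triangle of positive area on which the
  gradient is constant, so the area to the left of the chords jumps. On an affine piece of
  \<open>v\<close>, conversely, chords of many parameters leave the same point of the diameter. The
  factor \<open>1 / (1 + (v p)\<^sup>2)\<close> is Lipschitz in \<open>p\<close> and can carry the
  derivative instead. Throughout, \<open>v'\<close> is represented by the right derivative: it
  exists everywhere, is monotone and hence Borel, obeys the product and quotient rules, and equals
  \<open>deriv v\<close> off a countable set. The integration by parts is confined to compact
  intervals on which \<open>|p| < v p\<close>, because the derivative of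
  \<open>arccos (p / v p)\<close> has the factor \<open>1 / q\<close> and may be unbounded near the
  ends. The boundary terms are weighted areas of circular sectors that shrink to nothing, and the
  nonnegative integrand then supplies integrability over the full, possibly infinite,
  interval.\<close>

lemma right_quotients_tendsto:
  fixes F :: "real \<Rightarrow> real"
  assumes "(F has_real_derivative D) (at_right x)"
  shows "(\<lambda>n. real (Suc n) * (F (x + 1 / real (Suc n)) - F x)) \<longlonglongrightarrow> D"
proof -
  have "((\<lambda>y. (F y - F x) / (y - x)) \<longlongrightarrow> D) (at_right x)"
    using assms by (simp add: has_field_derivative_iff)
  moreover have "filterlim (\<lambda>n. x + 1 / real (Suc n)) (at_right x) sequentially"
    unfolding filterlim_at
  proof (intro conjI)
    show "(\<lambda>n. x + 1 / real (Suc n)) \<longlonglongrightarrow> x"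
      using tendsto_add[OF tendsto_const lim_1_over_n[THEN LIMSEQ_Suc], of x] by simp
  qed auto
  ultimately have "((\<lambda>n. (F (x + 1 / real (Suc n)) - F x) / (x + 1 / real (Suc n) - x)) \<longlongrightarrow> D) sequentially"
    by (rule filterlim_compose)
  then show ?thesis by (simp add: mult.commute)
qed

text \<open>The extra 1 makes the bound on the one-sided limit strict, so that nearby quotients
  inherit it. One good point to the right of every \<open>x\<close> is enough: continuity carries
  the estimate across the interval.\<close>

lemma lipschitz_on_if_right_derivative_bounded:
  fixes F :: "real \<Rightarrow> real"
  assumes F: "continuous_on {a..b} F"
    and D: "\<And>x. a \<le> x \<Longrightarrow> x < b \<Longrightarrow> (F has_real_derivative f x) (at_right x)"
    and B: "\<And>x. a \<le> x \<Longrightarrow> x < b \<Longrightarrow> \<bar>f x\<bar> \<le> B" "0 \<le> B"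
  shows "(B + 1)-lipschitz_on {a..b} F"
proof (rule locally_lipschitz_imp_lipschitz[OF F])
  fix x y assume x: "x \<in> {a..<b}" and "x < (y::real)"
  have "((\<lambda>z. (F z - F x) / (z - x)) \<longlongrightarrow> f x) (at_right x)"
    using D[of x] x by (simp add: has_field_derivative_iff)
  then have "((\<lambda>z. \<bar>(F z - F x) / (z - x)\<bar>) \<longlongrightarrow> \<bar>f x\<bar>) (at_right x)"
    by (rule tendsto_rabs)
  moreover have "\<bar>f x\<bar> < B + 1" using B(1)[of x] x by simp
  ultimately have "\<forall>\<^sub>F z in at_right x. \<bar>(F z - F x) / (z - x)\<bar> < B + 1"
    by (rule order_tendstoD)
  moreover have "\<forall>\<^sub>F z in at_right x. z \<in> {x<..<y}"
    using \<open>x < y\<close> by (rule eventually_at_right_real)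
  ultimately have "\<forall>\<^sub>F z in at_right x. \<bar>(F z - F x) / (z - x)\<bar> < B + 1 \<and> z \<in> {x<..<y}"
    by eventually_elim simp
  then obtain z where z: "\<bar>(F z - F x) / (z - x)\<bar> < B + 1" "x < z" "z < y"
    using eventually_happens'[OF trivial_limit_at_right_real] by fastforce
  then have "\<bar>F z - F x\<bar> / (z - x) < B + 1" by (simp add: abs_divide)
  then have "dist (F z) (F x) \<le> (B + 1) * (z - x)"
    using z by (simp add: dist_real_def field_simps)
  with z show "\<exists>z\<in>{x<..y}. dist (F z) (F x) \<le> (B + 1) * (z - x)" by force
qed (use B in simp)

text \<open>Right derivatives suffice because the right difference quotients are dominated
  (the derivative bound makes \<open>F\<close> Lipschitz) and their integrals telescope.\<close>
proposition fundamental_theorem_right_derivative: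
  fixes F f :: "real \<Rightarrow> real"
  assumes "a \<le> b" and F: "continuous_on {a..b} F"
    and D: "\<And>x. a \<le> x \<Longrightarrow> x < b \<Longrightarrow> (F has_real_derivative f x) (at_right x)"
    and B: "\<And>x. a \<le> x \<Longrightarrow> x < b \<Longrightarrow> \<bar>f x\<bar> \<le> B"
    and f: "f \<in> borel_measurable borel"
  shows "(LINT x:{a..b}|lborel. f x) = F b - F a"
proof (cases "a = b")
  case True
  have "(LINT x:{a..a}|lborel. f x) = 0"
    unfolding set_lebesgue_integral_def
  proof (rule integral_eq_zero_AE)
    show "AE x in lborel. indicator {a..a} x *\<^sub>R f x = 0"
      using AE_lborel_singleton[of a] by eventually_elim simp
  qed
  then show ?thesis using True by simp
next
  case False
  then have ab: "a < b" using \<open>a \<le> b\<close> by simp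
  have B0: "0 \<le> B" using B[of a] ab by simp
  \<comment> \<open>Extension by constants keeps the Lipschitz bound and gives a meaning to
    quotients whose right end leaves the interval.\<close>
  define E where "E x = F (max a (min b x))" for x
  have E_eq: "E x = F x" if "x \<in> {a..b}" for x using that by (simp add: E_def min_absorb2 max_absorb2)
  have "(B + 1)-lipschitz_on UNIV E"
  proof (rule lipschitz_onI)
    fix x y :: real
    have "dist (E x) (E y) \<le> (B + 1) * dist (max a (min b x)) (max a (min b y))"
      unfolding E_def using ab
      by (intro lipschitz_onD[OF lipschitz_on_if_right_derivative_bounded[OF F D B B0]]) auto
    also have "\<dots> \<le> (B + 1) * dist x y"
      using B0 by (intro mult_left_mono) (auto simp: dist_real_def)
    finally show "dist (E x) (E y) \<le> (B + 1) * dist x y" .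
  qed (use B0 in simp)
  note lip = this
  then have cont: "continuous_on A E" for A
    using lipschitz_on_continuous_on lipschitz_on_subset by blast
  then have [measurable]: "E \<in> borel_measurable borel"
    by (intro borel_measurable_continuous_onI)
  define g where "g n x = real (Suc n) * (E (x + 1 / real (Suc n)) - E x)" for n x
  have g_bound: "\<bar>g n x\<bar> \<le> B + 1" for n x
  proof -
    have "\<bar>g n x\<bar> = real (Suc n) * \<bar>E (x + 1 / real (Suc n)) - E x\<bar>"
      by (simp only: g_def abs_mult abs_of_nat)
    also have "\<dots> \<le> real (Suc n) * ((B + 1) * (1 / real (Suc n)))"
      using lipschitz_onD[OF lip, of "x + 1 / real (Suc n)" x]
      by (intro mult_left_mono) (auto simp: dist_real_def)
    finally show ?thesis by simp
  qed
  have D': "(E has_real_derivative f x) (at_right x)" if "a \<le> x" "x < b" for x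
    unfolding has_field_derivative_iff
  proof (rule Lim_transform_eventually)
    show "((\<lambda>y. (F y - F x) / (y - x)) \<longlongrightarrow> f x) (at_right x)"
      using D[OF that] by (simp add: has_field_derivative_iff)
    show "\<forall>\<^sub>F y in at_right x. (F y - F x) / (y - x) = (E y - E x) / (y - x)"
      using eventually_at_right_real[OF that(2)]
      by eventually_elim (use that in \<open>simp add: E_eq\<close>)
  qed
  have lim1: "(\<lambda>n. LINT x:{a..b}|lborel. g n x) \<longlonglongrightarrow> (LINT x:{a..b}|lborel. f x)"
    unfolding set_lebesgue_integral_def
  proof (rule integral_dominated_convergence)
    show "integrable lborel (\<lambda>x. indicator {a..b} x * (B + 1))"
      by (intro integrable_mult_left integrable_real_indicator) (auto simp: emeasure_lborel_Icc_eq)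
    show "AE x in lborel. (\<lambda>n. indicator {a..b} x *\<^sub>R g n x) \<longlonglongrightarrow> indicator {a..b} x *\<^sub>R f x"
      \<comment> \<open>To the right of \<open>b\<close> the extension is flat, whatever
        \<open>f b\<close> is, so this point is dropped.\<close>
      using AE_lborel_singleton[of b]
    proof eventually_elim
      case (elim x)
      then show ?case
        using right_quotients_tendsto[OF D', of x] unfolding g_def
        by (cases "x \<in> {a..b}") auto
    qed
    show "AE x in lborel. norm (indicator {a..b} x *\<^sub>R g n x) \<le> indicator {a..b} x * (B + 1)" for n
      using g_bound[of n] by (auto simp: indicator_def)
    show "(\<lambda>x. indicator {a..b} x *\<^sub>R g n x) \<in> borel_measurable lborel" for n
      unfolding g_def by measurable
  qed (use f in measurable)
  \<comment> \<open>With an antiderivative of \<open>E\<close>, the integral of \<open>g n\<close>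
    becomes a difference of two quotients of \<open>K\<close>, which tend to the values of
    \<open>E\<close> at \<open>b\<close> and \<open>a\<close>.\<close>
  define K where "K x = integral {a..x} E" for x
  have K: "(K has_real_derivative E x) (at x within S)" if "x \<in> {a..b + 1}" "S \<subseteq> {a..b + 1}" for x S
    unfolding K_def using that by (intro has_field_derivative_subset[OF integral_has_real_derivative] cont) auto
  have "(LINT x:{a..b}|lborel. g n x) =
    real (Suc n) * (K (b + 1 / real (Suc n)) - K b) - real (Suc n) * (K (a + 1 / real (Suc n)) - K a)" for n
  proof -
    define h where "h = 1 / real (Suc n)"
    have h: "0 < h" "h \<le> 1" by (auto simp: h_def)
    have "((\<lambda>x. real (Suc n) * (K (x + h) - K x)) has_vector_derivative g n x) (at x within {a..b})"
      if "a \<le> x" "x \<le> b" for x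
    proof -
      have 1: "((\<lambda>x. K (x + h)) has_real_derivative E (x + h) * 1) (at x within {a..b})"
        using that h ab by (intro DERIV_image_chain[of K _ "\<lambda>x. x + h", unfolded o_def] K)
          (auto intro!: derivative_eq_intros)
      have "((\<lambda>x. real (Suc n) * (K (x + h) - K x)) has_real_derivative real (Suc n) * (E (x + h) * 1 - E x))
          (at x within {a..b})"
        using that by (intro DERIV_cmult DERIV_diff 1 K) auto
      then show ?thesis
        unfolding has_real_derivative_iff_has_vector_derivative[symmetric] g_def h_def[symmetric] by simp
    qed
    from integral_FTC_Icc[OF \<open>a \<le> b\<close> this]
    moreover have "continuous_on {a..b} (g n)"
      unfolding g_def by (intro continuous_intros continuous_on_compose2[OF cont[of UNIV]] cont) auto
    ultimately show ?thesis
      unfolding set_lebesgue_integral_def h_def by (simp add: right_diff_distrib)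
  qed
  moreover have "(\<lambda>n. real (Suc n) * (K (x + 1 / real (Suc n)) - K x)) \<longlonglongrightarrow> E x" if "x \<in> {a..b}" for x
  proof (rule right_quotients_tendsto)
    have "(K has_real_derivative E x) (at x within {x<..<x + 1})"
      using that by (intro K) auto
    moreover have "at x within {x<..<x + 1} = at_right x"
      by (rule at_within_nhd[of x "{..<x + 1}"]) auto
    ultimately show "(K has_real_derivative E x) (at_right x)" by simp
  qed
  ultimately have "(\<lambda>n. LINT x:{a..b}|lborel. g n x) \<longlonglongrightarrow> E b - E a"
    using ab by (simp add: tendsto_diff)
  then have lim2: "(\<lambda>n. LINT x:{a..b}|lborel. g n x) \<longlonglongrightarrow> F b - F a"
    using ab by (simp add: E_eq)
  show ?thesis
    using LIMSEQ_unique[OF lim1 lim2] .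
qed

definition subgradient :: "(real \<Rightarrow> real) \<Rightarrow> real \<Rightarrow> real \<Rightarrow> bool"
  where "subgradient f p m \<longleftrightarrow> (\<forall>y. f p + m * (y - p) \<le> f y)"

text \<open>For convex \<open>f\<close> this is the right derivative and the largest subgradient at
  \<open>p\<close>, so it is meaningful at kinks as well.\<close>

definition right_slope :: "(real \<Rightarrow> real) \<Rightarrow> real \<Rightarrow> real"
  where "right_slope f p = Inf ((\<lambda>t. (f p - f t) / (p - t)) ` {p<..})"

lemma subgradient_right_slope:
  assumes "convex_on UNIV f"
  shows "subgradient f p (right_slope f p)"
  using convex_le_Inf_differential[OF assms, of p] by (simp add: subgradient_def right_slope_def)

lemma subgradient_mono:
  assumes "subgradient f p m" "subgradient f p' m'" "p < p'"
  shows "m \<le> m'"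
proof -
  have "f p + m * (p' - p) \<le> f p'" "f p' + m' * (p - p') \<le> f p"
    using assms by (auto simp: subgradient_def)
  then have "m * (p' - p) \<le> m' * (p' - p)" by (simp add: algebra_simps)
  then show ?thesis using assms(3) by simp
qed

text \<open>Needed at a kink, where the chord through a given point starts at an intermediate
  subgradient.\<close>

lemma subgradient_convex_comb:
  assumes "subgradient f p m" "subgradient f p m'" "0 \<le> t" "t \<le> 1"
  shows "subgradient f p ((1 - t) * m + t * m')"
  unfolding subgradient_def
proof
  fix y
  have "(1 - t) * (f p + m * (y - p)) + t * (f p + m' * (y - p)) \<le> (1 - t) * f y + t * f y"
    using assms by (intro add_mono mult_left_mono) (auto simp: subgradient_def)
  then show "f p + ((1 - t) * m + t * m') * (y - p) \<le> f y"
    by (simp add: algebra_simps)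
qed

text \<open>The subgradient inequality bounds the right quotients from below. A quotient close to
  the infimum bounds all earlier ones from above, since slopes of a convex function
  increase.\<close>

lemma right_slope_has_derivative:
  assumes "convex_on UNIV f"
  shows "(f has_real_derivative right_slope f p) (at_right p)"
proof -
  define q where "q t = (f p - f t) / (p - t)" for t
  have "((\<lambda>t. (f t - f p) / (t - p)) \<longlongrightarrow> right_slope f p) (at_right p)"
  proof (rule order_tendstoI)
    fix a assume a: "a < right_slope f p"
    have "\<forall>\<^sub>F t in at_right p. t \<in> {p<..<p + 1}"
      by (rule eventually_at_right_real) simp
    then show "\<forall>\<^sub>F t in at_right p. a < (f t - f p) / (t - p)"
    proof eventually_elim
      case (elim t)
      have "f p + right_slope f p * (t - p) \<le> f t"
        using subgradient_right_slope[OF assms] by (simp add: subgradient_def)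
      then have "right_slope f p \<le> (f t - f p) / (t - p)"
        using elim by (simp add: field_simps)
      then show ?case using a by simp
    qed
  next
    fix a assume "right_slope f p < a"
    then have "Inf (q ` {p<..}) < a" by (simp add: right_slope_def q_def[abs_def])
    then obtain s where s: "p < s" "q s < a"
      using cInf_lessD[of "q ` {p<..}" a] by auto
    have "\<forall>\<^sub>F t in at_right p. t \<in> {p<..<s}"
      using s by (intro eventually_at_right_real)
    then show "\<forall>\<^sub>F t in at_right p. (f t - f p) / (t - p) < a"
    proof eventually_elim
      case (elim t)
      have "(f t - f p) / (t - p) = q t"
        unfolding q_def by (metis minus_diff_eq minus_divide_divide)
      also have "\<dots> \<le> q s"
        using convex_on_slope_le(1)[OF assms, of p s t] elim by (simp add: q_def)
      finally show ?case using s by simp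
    qed
  qed
  then show ?thesis by (simp add: has_field_derivative_iff)
qed

text \<open>Wherever the monotone selection \<open>right_slope f\<close> is continuous it squeezes the difference quotients.\<close>
lemma DERIV_if_isCont_right_slope:
  assumes conv: "convex_on UNIV f" and cont: "isCont (right_slope f) p"
  shows "DERIV f p :> right_slope f p"
proof -
  let ?m = "right_slope f"
  have "norm ((f y - f p) / (y - p) - ?m p) \<le> norm (?m y - ?m p)" if "y \<noteq> p" for y
  proof -
    have 1: "?m p * (y - p) \<le> f y - f p" "f y - f p \<le> ?m y * (y - p)"
      using subgradient_right_slope[OF conv] unfolding subgradient_def
      by (smt (verit, ccfv_threshold) mult_minus_right)+
    show ?thesis
    proof (cases "p < y")
      case True
      then have "?m p \<le> (f y - f p) / (y - p)" "(f y - f p) / (y - p) \<le> ?m y"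
        using 1 by (simp_all add: field_simps)
      then show ?thesis by simp
    next
      case False
      then have "y - p < 0" using that by simp
      then have "(f y - f p) / (y - p) \<le> ?m p" "?m y \<le> (f y - f p) / (y - p)"
        using 1 by (simp_all add: neg_divide_le_eq neg_le_divide_eq)
      then show ?thesis by simp
    qed
  qed
  then have "\<forall>\<^sub>F y in at p. norm ((f y - f p) / (y - p) - ?m p) \<le> norm (?m y - ?m p)"
    by (simp add: eventually_at_filter)
  moreover have "((\<lambda>y. norm (?m y - ?m p)) \<longlongrightarrow> 0) (at p)"
    using cont by (simp add: isCont_def tendsto_rabs_zero_iff LIM_zero_iff)
  ultimately have "((\<lambda>y. (f y - f p) / (y - p) - ?m p) \<longlongrightarrow> 0) (at p)"
    by (rule Lim_null_comparison)
  then show ?thesis by (simp add: has_field_derivative_iff LIM_zero_iff)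
qed

lemma mono_right_slope: "convex_on UNIV f \<Longrightarrow> mono (right_slope f)"
  using subgradient_mono subgradient_right_slope unfolding mono_def
  by (metis order_le_less)

subsection \<open>Chords of the unit disc\<close>

text \<open>Seen from \<open>(1, 0)\<close>, the circle point of abscissa \<open>c\<close> has
  steepness \<open>s / (1 - c) = sqrt ((1 + c) / (1 - c))\<close>, which increases with
  \<open>c\<close>; a disc point is at most as steep as the circle point above it. The proof squares
  this comparison and clears denominators.\<close>

lemma chord_slope_less:
  fixes a b c s :: real
  assumes "c\<^sup>2 + s\<^sup>2 = 1" "s > 0" "a\<^sup>2 + b\<^sup>2 \<le> 1" "b \<ge> 0" "a \<le> c"
    and strict: "a < c \<or> a\<^sup>2 + b\<^sup>2 < 1"
  shows "b * (1 - c) < s * (1 - a)"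
proof -
  have "0 < s\<^sup>2" using assms(2) by simp
  then have "c\<^sup>2 < 1" using assms(1) by linarith
  then have c: "-1 < c" "c < 1" by (simp_all add: abs_square_less_1 abs_less_iff)
  have "a\<^sup>2 \<le> 1" using assms(3) by (smt (verit) zero_le_power2)
  then have a: "-1 \<le> a" by (simp add: abs_square_le_1 abs_le_iff)
  have b2: "b\<^sup>2 \<le> (1 - a) * (1 + a)" using assms(3) by (simp add: algebra_simps power2_eq_square)
  have s2: "s\<^sup>2 = (1 - c) * (1 + c)" using assms(1) by (simp add: algebra_simps power2_eq_square)
  have pos: "0 < (1 - c)\<^sup>2" "0 < (1 - a) * (1 - c)" using c assms(5) by auto
  have mid: "(1 - a) * (1 + a) * (1 - c)\<^sup>2 \<le> s\<^sup>2 * (1 - a)\<^sup>2 \<and>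
    (a < c \<longrightarrow> (1 - a) * (1 + a) * (1 - c)\<^sup>2 < s\<^sup>2 * (1 - a)\<^sup>2)"
  proof -
    have "s\<^sup>2 * (1 - a)\<^sup>2 - (1 - a) * (1 + a) * (1 - c)\<^sup>2 = (1 - a) * (1 - c) * (2 * (c - a))"
      unfolding s2 by (simp add: algebra_simps power2_eq_square)
    moreover have "0 \<le> (1 - a) * (1 - c) * (2 * (c - a))"
      using c assms(5) by (intro mult_nonneg_nonneg) auto
    moreover have "a < c \<Longrightarrow> 0 < (1 - a) * (1 - c) * (2 * (c - a))"
      using c by (intro mult_pos_pos) auto
    ultimately show ?thesis by linarith
  qed
  have "(b * (1 - c))\<^sup>2 < (s * (1 - a))\<^sup>2"
  proof (cases "a < c")
    case True
    have "b\<^sup>2 * (1 - c)\<^sup>2 \<le> (1 - a) * (1 + a) * (1 - c)\<^sup>2"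
      using b2 by (intro mult_right_mono) auto
    with mid True show ?thesis by (simp add: power_mult_distrib)
  next
    case False
    then have "b\<^sup>2 < (1 - a) * (1 + a)" using strict by (simp add: algebra_simps power2_eq_square)
    then have "b\<^sup>2 * (1 - c)\<^sup>2 < (1 - a) * (1 + a) * (1 - c)\<^sup>2"
      using pos(1) by (rule mult_strict_right_mono)
    with mid show ?thesis by (simp add: power_mult_distrib)
  qed
  then show ?thesis
    by (rule power2_less_imp_less) (use assms c in auto)
qed

lemma chord_slope_less':
  fixes a b c s :: real
  assumes "c\<^sup>2 + s\<^sup>2 = 1" "s > 0" "a\<^sup>2 + b\<^sup>2 \<le> 1" "b \<ge> 0" "c \<le> a"
    and "c < a \<or> a\<^sup>2 + b\<^sup>2 < 1"
  shows "b * (1 + c) < s * (1 + a)"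
  using chord_slope_less[of "-c" s "-a" b] assms by auto

text \<open>Negative exactly strictly to the left of the broken line through (c, -s), (m, 0), (c, s).\<close>
definition chord_side :: "real \<Rightarrow> real \<Rightarrow> real \<Rightarrow> real \<times> real \<Rightarrow> real"
  where "chord_side m c s x = s * (fst x - m) - (c - m) * \<bar>snd x\<bar>"

text \<open>The expression is affine in \<open>m\<close>, hence a convex combination of its values
  at \<open>m = 1\<close> and \<open>m = -1\<close>, whose signs are \<open>chord_slope_less\<close>
  and its mirror image.\<close>

lemma chord_side_circle_neg:
  assumes "c\<^sup>2 + s\<^sup>2 = 1" "s > 0" "c'\<^sup>2 + s'\<^sup>2 = 1" "s' > 0" "c' < c" "\<bar>m\<bar> \<le> 1"
  shows "chord_side m c s (c', s') < 0"
proof -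
  have 1: "s' * (1 - c) < s * (1 - c')"
    using chord_slope_less[of c s c' s'] assms by linarith
  have 2: "s * (1 + c') < s' * (1 + c)"
    using chord_slope_less'[of c' s' c s] assms by linarith
  have "2 * chord_side m c s (c', s') =
      (1 + m) * (s' * (1 - c) - s * (1 - c')) + (1 - m) * (s * (1 + c') - s' * (1 + c))"
    using assms by (simp add: chord_side_def algebra_simps)
  also have "\<dots> < 0"
  proof (cases "m = 1")
    case True then show ?thesis using 1 by simp
  next
    case False
    have "(1 + m) * (s' * (1 - c) - s * (1 - c')) \<le> 0"
      using assms 1 by (intro mult_nonneg_nonpos) auto
    moreover have "(1 - m) * (s * (1 + c') - s' * (1 + c)) < 0"
      using assms 2 False by (intro mult_pos_neg) auto
    ultimately show ?thesis by linarith
  qed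
  finally show ?thesis by simp
qed

lemma chord_side_circle_pos:
  assumes "c\<^sup>2 + s\<^sup>2 = 1" "s > 0" "c'\<^sup>2 + s'\<^sup>2 = 1" "s' > 0" "c < c'" "\<bar>m\<bar> \<le> 1"
  shows "chord_side m c s (c', s') > 0"
  using chord_side_circle_neg[of "-c" s "-c'" s' "-m"] assms by (simp add: chord_side_def algebra_simps)

text \<open>At heights \<open>|b| \<ge> s\<close> the coefficient \<open>|b| - s\<close> of
  \<open>m\<close> is nonnegative, so \<open>m = 1\<close> is the worst case. Hence above the end of
  the chord the sign does not depend on \<open>m\<close>.\<close>

lemma chord_side_above_neg:
  assumes "c\<^sup>2 + s\<^sup>2 = 1" "s > 0" "a\<^sup>2 + b\<^sup>2 < 1" "s \<le> \<bar>b\<bar>" "a \<le> c" "\<bar>m\<bar> \<le> 1"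
  shows "chord_side m c s (a, b) < 0"
proof -
  have 1: "\<bar>b\<bar> * (1 - c) < s * (1 - a)"
    using chord_slope_less[of c s a "\<bar>b\<bar>"] assms by simp
  have "chord_side m c s (a, b) \<le> \<bar>b\<bar> * (1 - c) - s * (1 - a)"
    using mult_right_mono[of m 1 "\<bar>b\<bar> - s"] assms by (simp add: chord_side_def algebra_simps)
  with 1 show ?thesis by simp
qed

lemma chord_side_above_pos:
  assumes "c\<^sup>2 + s\<^sup>2 = 1" "s > 0" "a\<^sup>2 + b\<^sup>2 < 1" "s \<le> \<bar>b\<bar>" "c \<le> a" "\<bar>m\<bar> \<le> 1"
  shows "chord_side m c s (a, b) > 0"
  using chord_side_above_neg[of "-c" s "-a" b "-m"] assms by (simp add: chord_side_def algebra_simps)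

text \<open>The zero set contains the full rays from \<open>(m, 0)\<close> through the circle
  points. Their parts beyond the circle are excluded because \<open>chord_side\<close> has a strict
  sign in the disc at heights \<open>\<ge> s\<close>.\<close>

lemma chord_side_zeroD:
  assumes cs: "c\<^sup>2 + s\<^sup>2 = 1" "s > 0" and m: "\<bar>m\<bar> \<le> 1" and x: "a\<^sup>2 + b\<^sup>2 < 1" "b \<noteq> 0"
    and D: "chord_side m c s (a, b) = 0"
  obtains t where "0 < t" "t < 1" "a = (1 - t) * m + t * c" "\<bar>b\<bar> = t * s"
proof
  show "0 < \<bar>b\<bar> / s" "\<bar>b\<bar> = \<bar>b\<bar> / s * s" using cs x by auto
  show "a = (1 - \<bar>b\<bar> / s) * m + \<bar>b\<bar> / s * c"
    using D cs by (simp add: chord_side_def field_simps)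
  show "\<bar>b\<bar> / s < 1"
  proof (rule ccontr)
    assume "\<not> \<bar>b\<bar> / s < 1"
    then have "s \<le> \<bar>b\<bar>" using cs by (simp add: field_simps)
    then show False
      using chord_side_above_neg[of c s a b m] chord_side_above_pos[of c s a b m] assms
      by (cases "a \<le> c") auto
  qed
qed

section \<open>Areas of regions in the disc\<close>

definition open_disc :: "(real \<times> real) set"
  where "open_disc = {x. (fst x)\<^sup>2 + (snd x)\<^sup>2 < 1}"

lemma open_disc_eq_ball: "open_disc = ball 0 1"
  by (auto simp: open_disc_def norm_Pair norm_prod_def)

lemma fmeasurable_open_disc: "open_disc \<in> fmeasurable lborel"
  unfolding open_disc_eq_ball by (intro fmeasurableI emeasure_bounded_finite) auto

lemma borel_open_disc [measurable]: "open_disc \<in> sets borel"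
  using fmeasurable_open_disc by (auto simp: fmeasurable_def)

lemma fmeasurable_disc_part:
  assumes "open {x. P x}"
  shows "{x \<in> open_disc. P x} \<in> fmeasurable lborel"
proof (rule fmeasurableI2[OF fmeasurable_open_disc])
  have "open (open_disc \<inter> {x. P x})" using assms by (auto simp: open_disc_eq_ball)
  moreover have "{x \<in> open_disc. P x} = open_disc \<inter> {x. P x}" by auto
  ultimately show "{x \<in> open_disc. P x} \<in> sets lborel" by simp
qed auto

lemma slice_open_disc:
  assumes "\<bar>y\<bar> \<le> 1"
  shows "x\<^sup>2 + y\<^sup>2 < 1 \<longleftrightarrow> - sqrt (1 - y\<^sup>2) < x \<and> x < sqrt (1 - y\<^sup>2)"
proof -
  have "x\<^sup>2 + y\<^sup>2 < 1 \<longleftrightarrow> sqrt (x\<^sup>2) < sqrt (1 - y\<^sup>2)"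
    by (simp only: real_sqrt_less_iff) linarith
  then show ?thesis by auto
qed

lemma measure_disc_left_of:
  assumes "-1 \<le> c" "c \<le> 1"
  shows "measure lborel {x \<in> open_disc. fst x < c} = pi - arccos c + c * sqrt (1 - c\<^sup>2)"
proof -
  let ?A = "{x \<in> open_disc. fst x < c}"
  have A: "?A \<in> fmeasurable lborel"
    by (intro fmeasurable_disc_part open_Collect_less continuous_intros)
  let ?K = "\<lambda>x. x * sqrt (1 - x\<^sup>2) - arccos x"
  \<comment> \<open>Differentiability is asked only in the interior: \<open>arccos\<close> has no
    derivative at -1, nor at \<open>c\<close> if \<open>c = 1\<close>.\<close>
  have "((\<lambda>x. 2 * sqrt (1 - x\<^sup>2)) has_integral (?K c - ?K (-1))) {-1..c}"
  proof (rule fundamental_theorem_of_calculus_interior)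
    show "continuous_on {-1..c} ?K"
      using assms by (intro continuous_intros continuous_on_arccos) auto
    fix x assume "x \<in> {-1<..<c}"
    then have x: "-1 < x" "x < 1" using assms by auto
    then have "x\<^sup>2 < 1" by (simp add: abs_square_less_1 abs_less_iff)
    then have "(?K has_real_derivative 2 * sqrt (1 - x\<^sup>2)) (at x)"
      using x by (auto intro!: derivative_eq_intros simp: field_simps power2_eq_square)
    then show "(?K has_vector_derivative 2 * sqrt (1 - x\<^sup>2)) (at x)"
      by (simp add: has_real_derivative_iff_has_vector_derivative)
  qed (use assms in auto)
  then have "integral {-1..c} (\<lambda>x. 2 * sqrt (1 - x\<^sup>2)) = ?K c - ?K (-1)"
    by (rule integral_unique)
  also have "\<dots> = pi - arccos c + c * sqrt (1 - c\<^sup>2)" by simp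
  finally have HK: "integral {-1..c} (\<lambda>x. 2 * sqrt (1 - x\<^sup>2)) = pi - arccos c + c * sqrt (1 - c\<^sup>2)" .
  have int: "set_integrable lborel {-1..c} (\<lambda>x. 2 * sqrt (1 - x\<^sup>2))"
    by (intro borel_integrable_atLeastAtMost' continuous_intros)
  have "measure lborel ?A = (\<integral>z. indicator ?A z \<partial>(lborel \<Otimes>\<^sub>M lborel))"
    by (simp add: lborel_prod)
  also have "\<dots> = (\<integral>x. (\<integral>y. indicator ?A (x, y) \<partial>lborel) \<partial>lborel)"
    using A by (intro lborel_pair.integral_fst'[symmetric]) (simp add: lborel_prod fmeasurable_def)
  also have "\<dots> = (LINT x:{-1..c}|lborel. 2 * sqrt (1 - x\<^sup>2))"
    unfolding set_lebesgue_integral_def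
  proof (rule integral_cong_AE)
    show "AE x in lborel. (\<integral>y. indicator ?A (x, y) \<partial>lborel) = indicator {-1..c} x *\<^sub>R (2 * sqrt (1 - x\<^sup>2))"
      using AE_lborel_singleton[of c]
    proof eventually_elim
      case (elim x)
      show ?case
      proof (cases "x \<in> {-1..c}")
        case True
        then have "(\<lambda>y. indicator ?A (x, y) :: real) = indicator {- sqrt (1 - x\<^sup>2)<..<sqrt (1 - x\<^sup>2)}"
          using elim assms slice_open_disc[of x] by (auto simp: open_disc_def indicator_def fun_eq_iff add.commute)
        moreover have "x\<^sup>2 \<le> 1" using True assms by (simp add: abs_square_le_1 abs_le_iff)
        ultimately show ?thesis using True by simp
      next
        case False
        have "indicator ?A (x, y) = (0::real)" for y
        proof (cases "x < c")
          case True
          then have "1 \<le> x\<^sup>2" using False by (simp add: abs_square_less_1 abs_less_iff not_less[symmetric])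
          then show ?thesis by (simp add: indicator_def open_disc_def add_nonneg_pos not_less add_increasing2)
        qed (simp add: indicator_def)
        then show ?thesis using False by simp
      qed
    qed
  qed (use A in \<open>measurable\<close>)
  also have "\<dots> = pi - arccos c + c * sqrt (1 - c\<^sup>2)"
    using HK set_borel_integral_eq_integral(2)[OF int] by simp
  finally show ?thesis .
qed

text \<open>Up to the factor \<open>m - c\<close>, the integrand is the signed width at height
  \<open>y\<close> of the triangle between a chord pair and the vertical line through its
  ends.\<close>

lemma integral_tent:
  assumes "0 < (s::real)"
  shows "(LINT y:{-s..s}|lborel. 1 - \<bar>y\<bar> / s) = s"
proof -
  let ?K = "\<lambda>y. y - y * \<bar>y\<bar> / (2 * s)"
  have "((\<lambda>y. 1 - \<bar>y\<bar> / s) has_integral (?K s - ?K (- s))) {-s..s}"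
  proof (rule fundamental_theorem_of_calculus_strong[where S = "{0}"])
    fix y assume "y \<in> {-s..s} - {0}"
    then have "(abs has_real_derivative sgn y) (at y)"
      using has_field_derivative_transform_within_open[of "\<lambda>y. y" 1 y "{0<..}" abs]
        has_field_derivative_transform_within_open[of "\<lambda>y. - y" "-1" y "{..<0}" abs]
        DERIV_minus[OF DERIV_ident, of y UNIV]
      by (cases "0 < y") auto
    then have "(?K has_real_derivative 1 - (1 * \<bar>y\<bar> + sgn y * y) / (2 * s)) (at y)"
      by (intro DERIV_diff DERIV_ident DERIV_cdivide DERIV_mult)
    moreover have "sgn y * y = \<bar>y\<bar>" by (simp add: abs_sgn mult.commute)
    ultimately have "(?K has_real_derivative 1 - \<bar>y\<bar> / s) (at y)" by simp
    then show "(?K has_vector_derivative 1 - \<bar>y\<bar> / s) (at y)"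
      by (simp add: has_real_derivative_iff_has_vector_derivative)
  qed (use assms in \<open>auto intro!: continuous_intros\<close>)
  then have "integral {-s..s} (\<lambda>y. 1 - \<bar>y\<bar> / s) = s"
    using assms by (simp add: integral_unique)
  moreover have "set_integrable lborel {-s..s} (\<lambda>y. 1 - \<bar>y\<bar> / s)"
    using assms by (intro borel_integrable_atLeastAtMost' continuous_intros) auto
  ultimately show ?thesis
    by (simp add: set_borel_integral_eq_integral(2))
qed

text \<open>The region differs from the part of the disc with abscissa below \<open>c\<close> by the triangle with
  vertices (c, -s), (m, 0), (c, s).\<close>
lemma measure_chord_side_neg:
  assumes cs: "c\<^sup>2 + s\<^sup>2 = 1" "0 < s" and m: "\<bar>m\<bar> \<le> 1"
  shows "measure lborel {x \<in> open_disc. chord_side m c s x < 0} = pi - arccos c + m * s"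
proof -
  let ?A = "{x \<in> open_disc. fst x < c}" and ?B = "{x \<in> open_disc. chord_side m c s x < 0}"
  have A: "?A \<in> fmeasurable lborel" and B: "?B \<in> fmeasurable lborel"
    unfolding chord_side_def by (intro fmeasurable_disc_part open_Collect_less continuous_intros)+
  have int: "integrable lborel (indicator ?A :: _ \<Rightarrow> real)" "integrable lborel (indicator ?B :: _ \<Rightarrow> real)"
    using A B by (auto simp: fmeasurable_def)
  let ?f = "\<lambda>z. indicator ?B z - indicator ?A z :: real"
  have "measure lborel ?B - measure lborel ?A = (\<integral>z. ?f z \<partial>lborel)"
    using int by simp
  also have "\<dots> = (\<integral>z. (case z of (x, y) \<Rightarrow> ?f (x, y)) \<partial>(lborel \<Otimes>\<^sub>M lborel))"
    by (simp add: lborel_prod)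
  also have "\<dots> = (\<integral>y. (\<integral>x. ?f (x, y) \<partial>lborel) \<partial>lborel)"
    using int by (intro lborel_pair.integral_snd[symmetric]) (auto simp: lborel_prod split_beta')
  also have "\<dots> = (\<integral>y. (m - c) * (indicator {-s..s} y * (1 - \<bar>y\<bar> / s)) \<partial>lborel)"
  proof (intro Bochner_Integration.integral_cong refl)
    fix y :: real
    show "(\<integral>x. ?f (x, y) \<partial>lborel) = (m - c) * (indicator {-s..s} y * (1 - \<bar>y\<bar> / s))"
    proof (cases "\<bar>y\<bar> < s")
      case True
      define t where "t = \<bar>y\<bar> / s"
      define l where "l = (1 - t) * m + t * c"
      define r where "r = sqrt (1 - y\<^sup>2)"
      have t: "0 \<le> t" "t < 1" "\<bar>y\<bar> = t * s" using True cs by (auto simp: t_def)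
      have y2: "y\<^sup>2 = t\<^sup>2 * s\<^sup>2" using t(3) by (metis power2_abs power_mult_distrib)
      have y2s: "y\<^sup>2 \<le> s\<^sup>2" using True by (intro abs_le_square_iff[THEN iffD1]) simp
      have s1: "s\<^sup>2 \<le> 1" using cs zero_le_power2[of c] by linarith
      \<comment> \<open>The point \<open>(l, |y|)\<close> divides the segment from
        \<open>(m, 0)\<close> to \<open>(c, s)\<close>, so it stays in the closed disc by convexity
        of the square; thus the broken line really cuts this slice.\<close>
      have "l\<^sup>2 \<le> 1 - y\<^sup>2"
      proof -
        have "l\<^sup>2 = (1 - t) * m\<^sup>2 + t * c\<^sup>2 - t * (1 - t) * (m - c)\<^sup>2"
          by (simp add: l_def power2_eq_square algebra_simps)
        also have "\<dots> \<le> (1 - t) * m\<^sup>2 + t * c\<^sup>2" using t by simp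
        also have "\<dots> \<le> (1 - t) * 1 + t * c\<^sup>2"
          using t m by (intro add_right_mono mult_left_mono) (auto simp: abs_square_le_1)
        also have "c\<^sup>2 = 1 - s\<^sup>2" using cs(1) by simp
        also have "(1 - t) * 1 + t * (1 - s\<^sup>2) = 1 - t * s\<^sup>2" by (simp add: algebra_simps)
        also have "\<dots> \<le> 1 - t\<^sup>2 * s\<^sup>2"
          using t by (intro diff_left_mono mult_right_mono) (auto simp: power2_eq_square mult_left_le)
        finally show ?thesis unfolding y2 .
      qed
      then have l: "- r \<le> l" "l \<le> r" unfolding r_def
        by (auto intro: real_le_rsqrt simp: minus_le_iff)
      have "c\<^sup>2 \<le> 1 - y\<^sup>2" using cs y2s by simp
      then have c: "- r \<le> c" "c \<le> r" unfolding r_def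
        by (auto intro: real_le_rsqrt simp: minus_le_iff)
      have "y\<^sup>2 \<le> 1" using y2s s1 by simp
      then have y1: "\<bar>y\<bar> \<le> 1" by (simp add: abs_square_le_1)
      have "chord_side m c s (x, y) < 0 \<longleftrightarrow> x < l" for x
      proof -
        have "chord_side m c s (x, y) = s * (x - l)"
          unfolding chord_side_def l_def using t(3) by (simp add: algebra_simps)
        then show ?thesis using cs by (simp add: mult_less_0_iff)
      qed
      moreover have disc: "(x, y) \<in> open_disc \<longleftrightarrow> - r < x \<and> x < r" for x
        using slice_open_disc[OF y1, of x] by (simp add: open_disc_def r_def)
      ultimately have "(x, y) \<in> ?B \<longleftrightarrow> x \<in> {-r<..<l}" for x
        using l by (simp only: mem_Collect_eq greaterThanLessThan_iff) linarith
      moreover have "(x, y) \<in> ?A \<longleftrightarrow> x \<in> {-r<..<c}" for x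
        using c disc[of x] by (simp only: mem_Collect_eq greaterThanLessThan_iff fst_conv) linarith
      ultimately have "?f (x, y) = indicator {-r<..<l} x - indicator {-r<..<c} x" for x
        by (simp only: indicator_def)
      then have "(\<integral>x. ?f (x, y) \<partial>lborel) = (\<integral>x. indicator {-r<..<l} x - indicator {-r<..<c} x \<partial>lborel)"
        by (simp only:)
      also have "\<dots> = l - c" using l c by simp
      also have "\<dots> = (m - c) * (1 - t)" by (simp add: l_def algebra_simps)
      finally show ?thesis using True by (simp add: t_def abs_less_iff less_imp_le)
    next
      case False
      \<comment> \<open>Beyond height \<open>s\<close> the prolonged broken line and the vertical
        line separate the points of the disc in the same way.\<close>
      have "(x, y) \<in> ?B \<longleftrightarrow> (x, y) \<in> ?A" for x
        using chord_side_above_neg[OF cs, of x y m] chord_side_above_pos[OF cs, of x y m] m False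
        by (cases "x < c") (force simp: open_disc_def)+
      then have "?f (x, y) = 0" for x by (simp add: indicator_def)
      moreover have "indicator {-s..s} y * (1 - \<bar>y\<bar> / s) = 0"
        using False cs by (auto simp: indicator_def)
      ultimately show ?thesis by simp
    qed
  qed
  also have "\<dots> = (m - c) * s"
    using integral_tent[OF cs(2)] by (simp add: set_lebesgue_integral_def)
  finally have "measure lborel ?B = measure lborel ?A + (m - c) * s" by simp
  moreover have "s = sqrt (1 - c\<^sup>2)" using cs by (intro real_sqrt_unique[symmetric]) auto
  moreover have "c\<^sup>2 \<le> 1" using cs(1) zero_le_power2[of s] by linarith
  then have "\<bar>c\<bar> \<le> 1" by (simp add: abs_square_le_1)
  ultimately show ?thesis
    using measure_disc_left_of[of c] by (simp add: abs_le_iff algebra_simps)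
qed

subsection \<open>The chord through a point\<close>

locale profile =
  fixes v :: "real \<Rightarrow> real" and M :: real
  assumes conv: "convex_on UNIV v"
    and lower: "\<bar>p\<bar> \<le> v p"
    and upper: "v p \<le> \<bar>p\<bar> + M"
    and v0: "0 < v 0"
begin

lemma v_pos: "0 < v p"
  using lower[of p] v0 by (cases "p = 0") auto

lemma M_pos: "0 < M"
  using v0 upper[of 0] by simp

lemma subgradient_bound:
  assumes "subgradient v p m"
  shows "\<bar>m\<bar> \<le> 1"
proof (rule ccontr)
  assume "\<not> \<bar>m\<bar> \<le> 1"
  then have m: "\<bar>m\<bar> - 1 > 0" by simp
  \<comment> \<open>At distance \<open>t\<close> in the direction of \<open>m\<close> the supporting
    line gains \<open>(|m| - 1) * t = M + 1\<close> on the growth of \<open>|p|\<close>, more than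
    the available gap \<open>M\<close>.\<close>
  define t where "t = (M + 1) / (\<bar>m\<bar> - 1)"
  have t: "t > 0" using m M_pos by (simp add: t_def)
  have "v p + m * (sgn m * t) \<le> v (p + sgn m * t)"
    using assms unfolding subgradient_def by (metis add_diff_cancel_left')
  also have "\<dots> \<le> \<bar>p + sgn m * t\<bar> + M" by (rule upper)
  also have "\<dots> \<le> \<bar>p\<bar> + t + M"
    using t abs_triangle_ineq[of p "sgn m * t"] by (simp add: abs_mult sgn_if split: if_splits)
  finally have "v p + \<bar>m\<bar> * t \<le> \<bar>p\<bar> + t + M"
    by (simp add: mult.assoc[symmetric] abs_sgn)
  then have "(\<bar>m\<bar> - 1) * t \<le> M"
    using lower[of p] by (simp add: algebra_simps)
  then show False using m by (simp add: t_def)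
qed

abbreviation slope :: "real \<Rightarrow> real"
  where "slope \<equiv> right_slope v"

lemma subgradient_slope: "subgradient v p (slope p)"
  using conv by (rule subgradient_right_slope)

lemma slope_bound: "\<bar>slope p\<bar> \<le> 1"
  using subgradient_slope by (rule subgradient_bound)

lemma lipschitz: "\<bar>v x - v y\<bar> \<le> \<bar>x - y\<bar>"
proof -
  have "v y - v x \<le> \<bar>x - y\<bar>" for x y
  proof -
    have "v y - v x \<le> slope y * (y - x)"
      using subgradient_slope[of y] by (auto simp: subgradient_def algebra_simps dest: spec[of _ x])
    also have "\<dots> \<le> \<bar>slope y\<bar> * \<bar>y - x\<bar>" by (metis abs_ge_self abs_mult)
    also have "\<dots> \<le> 1 * \<bar>y - x\<bar>" using slope_bound by (intro mult_right_mono) auto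
    finally show ?thesis by (simp add: abs_minus_commute)
  qed
  from this[of x y] this[of y x] show ?thesis by (simp add: abs_minus_commute)
qed

lemma continuous_v: "continuous_on A v"
proof (rule lipschitz_on_continuous_on)
  show "1-lipschitz_on A v"
    by (rule lipschitz_onI) (use lipschitz in \<open>auto simp: dist_real_def\<close>)
qed

lemma isCont_v: "isCont v p"
  using continuous_v[of UNIV] by (simp add: continuous_on_eq_continuous_at)

text \<open>Exactly here \<open>sine\<close> is positive and a chord leaves the diameter. It is the
  open interval of integration, see \<open>einterval_active\<close>.\<close>

definition active :: "real set"
  where "active = {p. \<bar>p\<bar> < v p}"

definition cosine :: "real \<Rightarrow> real"
  where "cosine p = p / v p"

definition sine :: "real \<Rightarrow> real"
  where "sine p = sqrt ((v p)\<^sup>2 - p\<^sup>2) / v p"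

lemma sqrt_pos: "p \<in> active \<Longrightarrow> 0 < sqrt ((v p)\<^sup>2 - p\<^sup>2)"
  using power_strict_mono[of "\<bar>p\<bar>" "v p" 2] by (simp add: active_def)

lemma sq_le: "p\<^sup>2 \<le> (v p)\<^sup>2"
  using lower[of p] v_pos[of p] by (intro abs_le_square_iff[THEN iffD1]) simp

lemma sine_pos: "p \<in> active \<Longrightarrow> 0 < sine p"
  using sqrt_pos v_pos by (simp add: sine_def)

lemma cosine_sine: "(cosine p)\<^sup>2 + (sine p)\<^sup>2 = 1"
  using sq_le[of p] v_pos[of p] by (simp add: cosine_def sine_def power_divide add_divide_distrib[symmetric])

lemma cosine_bounds: "p \<in> active \<Longrightarrow> -1 < cosine p" "p \<in> active \<Longrightarrow> cosine p < 1"
  using v_pos[of p] by (auto simp: cosine_def active_def field_simps)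

lemma zero_active: "0 \<in> active"
  using v0 by (simp add: active_def)

lemma open_active: "open active"
  unfolding active_def by (intro open_Collect_less continuous_intros continuous_v)

text \<open>By the Lipschitz bound \<open>v p - p\<close> is nonincreasing and
  \<open>v p + p\<close> nondecreasing, so each of the two defining inequalities is inherited in one
  direction.\<close>

lemma is_interval_active: "is_interval active"
  unfolding is_interval_1
proof (intro ballI allI impI, elim conjE)
  fix a b x assume "a \<in> active" "b \<in> active" "a \<le> x" "x \<le> b"
  then show "x \<in> active"
    using lipschitz[of a x] lipschitz[of x b] by (auto simp: active_def)
qed

text \<open>Formally the derivative is \<open>(v p - p * v' p) / (v p)\<^sup>2\<close>, positive
  because \<open>|v'| \<le> 1\<close> and \<open>|p| < v p\<close>. The Lipschitz bound replaces the
  derivative.\<close>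

lemma cosine_strict_mono:
  assumes "a \<in> active" "b \<in> active" "a < b"
  shows "cosine a < cosine b"
proof -
  have "a * v b < b * v a"
  proof (cases "0 \<le> a")
    case True
    have "a * v b \<le> a * (v a + (b - a))"
      using lipschitz[of b a] assms True by (intro mult_left_mono) auto
    also have "\<dots> < b * v a"
      using mult_strict_right_mono[of a "v a" "b - a"] assms by (simp add: active_def algebra_simps)
    finally show ?thesis .
  next
    case a: False
    show ?thesis
    proof (cases "0 \<le> b")
      case True
      have "a * v b < 0" "0 \<le> b * v a" using a True v_pos by (auto simp: mult_neg_pos less_imp_le)
      then show ?thesis by simp
    next
      case False
      have "a * v b < b * (v b + (b - a))"
        using mult_strict_right_mono[of "- b" "v b" "b - a"] assms by (simp add: active_def algebra_simps)
      also have "\<dots> \<le> b * v a"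
        using lipschitz[of b a] assms False by (intro mult_left_mono_neg) auto
      finally show ?thesis .
    qed
  qed
  then show ?thesis using v_pos by (simp add: cosine_def divide_simps)
qed

text \<open>The equation \<open>p = k * v p\<close> is solved by the intermediate value theorem; a
  root is active automatically because \<open>|k| < 1\<close>.\<close>

lemma cosine_surj:
  assumes "\<bar>k\<bar> < 1"
  obtains p where "p \<in> active" "cosine p = k"
proof -
  \<comment> \<open>The choice \<open>(1 - |k|) * R = M\<close> gives
    \<open>|k| * (R + M) < R\<close>, so \<open>x - k * v x\<close> has opposite signs at
    \<open>R\<close> and \<open>- R\<close>.\<close>
  define R where "R = M / (1 - \<bar>k\<bar>)"
  have R: "0 < R" "\<bar>k\<bar> * (R + M) < R"
  proof -
    show "0 < R" using assms M_pos by (simp add: R_def)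
    have "\<bar>k\<bar> * M < M" using assms M_pos by simp
    moreover have "(1 - \<bar>k\<bar>) * R = M" using assms by (simp add: R_def)
    ultimately show "\<bar>k\<bar> * (R + M) < R" by (simp add: algebra_simps)
  qed
  have bd: "\<bar>k * v x\<bar> < R" if "\<bar>x\<bar> = R" for x
  proof -
    have "\<bar>k * v x\<bar> \<le> \<bar>k\<bar> * (R + M)"
      using upper[of x] v_pos[of x] that by (auto simp: abs_mult intro!: mult_left_mono)
    then show ?thesis using R by simp
  qed
  have "\<exists>x\<ge>- R. x \<le> R \<and> x - k * v x = 0"
    using bd[of R] bd[of "- R"] R
    by (intro IVT' continuous_intros continuous_v) auto
  then obtain x where x: "x = k * v x" by auto
  have "\<bar>x\<bar> = \<bar>k\<bar> * v x" using x v_pos[of x] by (metis abs_mult abs_of_pos)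
  also have "\<dots> < 1 * v x" using assms v_pos by (intro mult_strict_right_mono)
  finally have "x \<in> active" by (simp add: active_def)
  moreover have "cosine x = k" using x v_pos[of x] by (simp add: cosine_def field_simps)
  ultimately show ?thesis by (rule that)
qed

section \<open>Order of the chords and the parameter of a point\<close>

definition side :: "real \<Rightarrow> real \<times> real \<Rightarrow> real"
  where "side p = chord_side (slope p) (cosine p) (sine p)"

definition on_chord :: "real \<Rightarrow> real \<Rightarrow> real \<times> real \<Rightarrow> bool"
  where "on_chord p m x \<longleftrightarrow> p \<in> active \<and> subgradient v p m \<and> chord_side m (cosine p) (sine p) x = 0"

text \<open>The diameter, a null set, is removed because the candidate gradients
  \<open>(p, q)\<close> and \<open>(p, -q)\<close> from its two sides differ.\<close>

definition half_discs :: "(real \<times> real) set"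
  where "half_discs = {x. (fst x)\<^sup>2 + (snd x)\<^sup>2 < 1 \<and> snd x \<noteq> 0}"

lemma on_chord_point:
  assumes "on_chord p m x" "x \<in> half_discs"
  obtains t where "0 < t" "t < 1" "fst x = (1 - t) * m + t * cosine p" "\<bar>snd x\<bar> = t * sine p"
  using chord_side_zeroD[of "cosine p" "sine p" m "fst x" "snd x"] assms sine_pos[of p] cosine_sine[of p]
    subgradient_bound[of p m]
  unfolding on_chord_def half_discs_def by auto

lemma chord_side_on_chord:
  assumes "fst x = (1 - t) * m' + t * c'" "\<bar>snd x\<bar> = t * s'"
  shows "chord_side m c s x = (1 - t) * (s * (m' - m)) + t * (s * (c' - m) - (c - m) * s')"
  unfolding chord_side_def assms by (simp add: algebra_simps)

text \<open>Chords of different parameters do not cross: the circle end of the earlier chord is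
  strictly to the left, by monotonicity of \<open>cosine\<close>, and its diameter end weakly, by
  monotonicity of subgradients. Since \<open>chord_side\<close> interpolates between the ends and
  \<open>x\<close> is not on the diameter, the sign at \<open>x\<close> is strict.\<close>

lemma side_neg_after:
  assumes "on_chord p m x" "x \<in> half_discs" "p < p'" "p' \<in> active"
  shows "side p' x < 0"
proof -
  obtain t where t: "0 < t" "t < 1" "fst x = (1 - t) * m + t * cosine p" "\<bar>snd x\<bar> = t * sine p"
    using on_chord_point assms by blast
  have p: "p \<in> active" "subgradient v p m" using assms by (auto simp: on_chord_def)
  have "chord_side (slope p') (cosine p') (sine p') (cosine p, sine p) < 0"
    using p assms sine_pos cosine_sine slope_bound cosine_strict_mono by (intro chord_side_circle_neg) auto
  then have "t * (sine p' * (cosine p - slope p') - (cosine p' - slope p') * sine p) < 0"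
    using t sine_pos[OF p(1)] by (intro mult_pos_neg) (auto simp: chord_side_def)
  moreover have "m \<le> slope p'"
    using p assms subgradient_mono subgradient_slope by blast
  then have "(1 - t) * (sine p' * (m - slope p')) \<le> 0"
    using t sine_pos assms by (intro mult_nonneg_nonpos) (auto simp: less_imp_le)
  ultimately show ?thesis
    unfolding side_def chord_side_on_chord[OF t(3,4)] by simp
qed

lemma side_pos_before:
  assumes "on_chord p m x" "x \<in> half_discs" "p' < p" "p' \<in> active"
  shows "0 < side p' x"
proof -
  obtain t where t: "0 < t" "t < 1" "fst x = (1 - t) * m + t * cosine p" "\<bar>snd x\<bar> = t * sine p"
    using on_chord_point assms by blast
  have p: "p \<in> active" "subgradient v p m" using assms by (auto simp: on_chord_def)
  have "0 < chord_side (slope p') (cosine p') (sine p') (cosine p, sine p)"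
    using p assms sine_pos cosine_sine slope_bound cosine_strict_mono by (intro chord_side_circle_pos) auto
  then have "0 < t * (sine p' * (cosine p - slope p') - (cosine p' - slope p') * sine p)"
    using t sine_pos[OF p(1)] by (intro mult_pos_pos) (auto simp: chord_side_def)
  moreover have "slope p' \<le> m"
    using p assms subgradient_mono subgradient_slope by blast
  then have "0 \<le> (1 - t) * (sine p' * (m - slope p'))"
    using t sine_pos assms by (intro mult_nonneg_nonneg) (auto simp: less_imp_le)
  ultimately show ?thesis
    unfolding side_def chord_side_on_chord[OF t(3,4)] by simp
qed

lemma continuous_cosine: "continuous_on A cosine"
  unfolding cosine_def by (intro continuous_intros continuous_v) (use v_pos in \<open>auto simp: less_le\<close>)

lemma continuous_sine: "continuous_on A sine"
  unfolding sine_def by (intro continuous_intros continuous_v) (use v_pos in \<open>auto simp: less_le\<close>)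

lemma closed_subgradient_graph: "closed {z. subgradient v (snd z) (fst z)}"
  unfolding subgradient_def
  by (intro closed_Collect_all closed_Collect_le continuous_intros
        continuous_on_compose2[OF continuous_v[of UNIV]]) auto

lemma continuous_chord_side_graph:
  "continuous_on A (\<lambda>z. chord_side (fst z) (cosine (snd z)) (sine (snd z)) x)"
  unfolding chord_side_def
  by (intro continuous_intros continuous_on_compose2[OF continuous_cosine[of UNIV]]
        continuous_on_compose2[OF continuous_sine[of UNIV]]) auto

text \<open>The parameters whose chord passes weakly to the left, respectively to the right, of \<open>x\<close> form
  two closed sets covering the connected set \<open>active\<close>, so they meet.\<close>
lemma ex_on_chord:
  assumes "x \<in> half_discs"
  obtains p m where "on_chord p m x"
proof -
  define g where "g z = chord_side (fst z) (cosine (snd z)) (sine (snd z)) x" for z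
  define J where "J = {p \<in> active. \<exists>m. subgradient v p m \<and> g (m, p) \<le> 0}"
  define K where "K = {p \<in> active. \<exists>m. subgradient v p m \<and> g (m, p) \<ge> 0}"
  \<comment> \<open>Subgradients lie in \<open>[-1, 1]\<close>, so eliminating \<open>m\<close> is a
    projection along a compact factor, which preserves closedness.\<close>
  have cl: "closedin (top_of_set active) {p \<in> active. \<exists>m. subgradient v p m \<and> (m, p) \<in> C}"
    if "closed C" for C
  proof -
    let ?U = "({-1..1} \<times> active) \<inter> ({z. subgradient v (snd z) (fst z)} \<inter> C)"
    have "closedin (top_of_set active) {p. \<exists>m. m \<in> {-1..1} \<and> (m, p) \<in> ?U}"
      by (rule closedin_compact_projection[where S = "{-1..1::real}"])
        (intro closedin_closed_Int closed_Int closed_subgradient_graph that compact_Icc)+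
    also have "{p. \<exists>m. m \<in> {-1..1} \<and> (m, p) \<in> ?U} = {p \<in> active. \<exists>m. subgradient v p m \<and> (m, p) \<in> C}"
      using subgradient_bound by (fastforce simp: abs_le_iff)
    finally show ?thesis .
  qed
  have g: "continuous_on UNIV g"
    unfolding g_def[abs_def] by (rule continuous_chord_side_graph)
  have "closed {z. g z \<le> 0}" "closed {z. 0 \<le> g z}"
    using g by (intro closed_Collect_le continuous_on_const; simp)+
  then have "closedin (top_of_set active) J" "closedin (top_of_set active) K"
    using cl unfolding J_def K_def by fastforce+
  moreover have "J \<union> K = active"
    using subgradient_slope linorder_linear unfolding J_def K_def by blast
  moreover have "J \<noteq> {} \<and> K \<noteq> {}"
  proof -
    obtain a b where x: "x = (a, b)" by (cases x)
    \<comment> \<open>The chords with cosine \<open>k\<close> and \<open>- k\<close> end at the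
      height of \<open>x\<close>, so the sign of \<open>chord_side\<close> at \<open>x\<close> is
      known whatever the slope.\<close>
    define k where "k = sqrt (1 - b\<^sup>2)"
    have ab: "a\<^sup>2 + b\<^sup>2 < 1" "b \<noteq> 0" using assms by (auto simp: half_discs_def x)
    have b1: "b\<^sup>2 \<le> 1" using ab zero_le_power2[of a] by linarith
    have k2: "k\<^sup>2 = 1 - b\<^sup>2" using b1 by (simp add: k_def)
    have k: "0 \<le> k" "k < 1" "\<bar>a\<bar> \<le> k"
      using ab b1 by (auto simp: k_def intro!: real_le_rsqrt)
    have sb: "sine p = \<bar>b\<bar>" if "p \<in> active" "(cosine p)\<^sup>2 = k\<^sup>2" for p
    proof -
      have "(sine p)\<^sup>2 = \<bar>b\<bar>\<^sup>2" using cosine_sine[of p] k2 that by simp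
      then show ?thesis using sine_pos[OF that(1)] power2_eq_imp_eq[of "sine p" "\<bar>b\<bar>"] by simp
    qed
    obtain p where p: "p \<in> active" "cosine p = k" using cosine_surj[of k] k by auto
    obtain p' where p': "p' \<in> active" "cosine p' = - k" using cosine_surj[of "- k"] k by auto
    have "g (slope p, p) < 0"
      using p k ab sb[of p] cosine_sine[of p] sine_pos[of p] slope_bound
      unfolding g_def x by (auto intro!: chord_side_above_neg)
    then have "p \<in> J" using p subgradient_slope[of p] by (auto simp: J_def intro!: exI[of _ "slope p"])
    have "g (slope p', p') > 0"
      using p' k ab sb[of p'] cosine_sine[of p'] sine_pos[of p'] slope_bound
      unfolding g_def x by (auto intro!: chord_side_above_pos)
    then have "p' \<in> K" using p' subgradient_slope[of p'] by (auto simp: K_def intro!: exI[of _ "slope p'"])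
    with \<open>p \<in> J\<close> show ?thesis by auto
  qed
  moreover have "connected active"
    using is_interval_active by (simp add: is_interval_connected_1)
  ultimately have "J \<inter> K \<noteq> {}"
    unfolding connected_closedin_eq by blast
  then obtain p m m' where p: "p \<in> active" "subgradient v p m" "g (m, p) \<le> 0"
      "subgradient v p m'" "g (m', p) \<ge> 0"
    by (auto simp: J_def K_def)
  \<comment> \<open>At the common parameter two subgradients put \<open>x\<close> weakly on opposite
    sides; some subgradient between them puts the chord through \<open>x\<close>.\<close>
  define h where "h t = g ((1 - t) * m + t * m', p)" for t
  have "\<exists>t\<ge>0. t \<le> 1 \<and> h t = 0"
    unfolding h_def using p
    by (intro IVT' continuous_intros continuous_on_compose2[OF g]) auto
  then obtain t where t: "0 \<le> t" "t \<le> 1" "h t = 0" by auto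
  then have "on_chord p ((1 - t) * m + t * m') x"
    using p unfolding on_chord_def h_def g_def by (auto intro: subgradient_convex_comb)
  then show ?thesis by (rule that)
qed

text \<open>On \<open>half_discs\<close> the choice is unambiguous: a parameter strictly between two
  candidates would have \<open>side\<close> both negative and positive at \<open>x\<close>.\<close>

definition contact :: "real \<times> real \<Rightarrow> real"
  where "contact x = (SOME p. \<exists>m. on_chord p m x)"

lemma on_chord_contact:
  assumes "x \<in> half_discs"
  obtains m where "on_chord (contact x) m x"
  unfolding contact_def using ex_on_chord[OF assms] someI_ex[of "\<lambda>p. \<exists>m. on_chord p m x"] by metis

lemma contact_active: "x \<in> half_discs \<Longrightarrow> contact x \<in> active"
  by (metis on_chord_contact on_chord_def)

text \<open>At \<open>p = contact x\<close> itself the sign depends on whether the selected slope is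
  the subgradient of the chord through \<open>x\<close>. In integrals over \<open>p\<close> this one
  point has measure zero.\<close>

lemma side_neg_iff:
  assumes "x \<in> half_discs" "p \<in> active" "p \<noteq> contact x"
  shows "side p x < 0 \<longleftrightarrow> contact x < p"
proof -
  obtain m where m: "on_chord (contact x) m x" using on_chord_contact assms by blast
  show ?thesis
    using side_neg_after[OF m assms(1) _ assms(2)] side_pos_before[OF m assms(1) _ assms(2)] assms(3)
    by (cases "contact x < p") (force simp: not_less)+
qed

lemma side_pos_if:
  assumes "x \<in> half_discs" "p \<in> active" "p < contact x"
  shows "0 < side p x"
  using assms on_chord_contact side_pos_before by metis

lemma open_half_discs: "open half_discs"
  unfolding half_discs_def
  by (intro open_Collect_conj open_Collect_less open_Collect_neq continuous_intros)

lemma continuous_side: "continuous_on A (side p)"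
  unfolding side_def chord_side_def by (intro continuous_intros)

text \<open>For \<open>p\<close> just below or just above \<open>contact x\<close> the strict sign
  of \<open>side p\<close> persists near \<open>x\<close>, and these signs trap the nearby values of
  \<open>contact\<close>.\<close>

lemma isCont_contact:
  assumes x: "x \<in> half_discs"
  shows "isCont contact x"
  unfolding isCont_def
proof (rule order_tendstoI)
  have nhd: "\<forall>\<^sub>F y in at x. y \<in> half_discs"
    using open_half_discs x by (rule eventually_at_in_open')
  have lim: "(side p \<longlongrightarrow> side p x) (at x)" for p
    using continuous_side[of UNIV p] by (metis UNIV_I continuous_on_eq_continuous_at isCont_def open_UNIV)
  obtain e where e: "e > 0" "ball (contact x) e \<subseteq> active"
    using open_active contact_active[OF x] open_contains_ball by blast
  {
    fix a assume a: "a < contact x"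
    define p where "p = max ((a + contact x) / 2) (contact x - e / 2)"
    have "contact x - e < p" "p < contact x" using a e by (simp_all add: p_def less_max_iff_disj)
    then have "p \<in> ball (contact x) e" by (simp add: dist_real_def)
    then have p: "p \<in> active" "a < p" "p < contact x" using e a by (auto simp: p_def less_max_iff_disj)
    have "\<forall>\<^sub>F y in at x. 0 < side p y"
      using order_tendstoD(1)[OF lim side_pos_if[OF x p(1,3)]] .
    with nhd show "\<forall>\<^sub>F y in at x. a < contact y"
    proof eventually_elim
      case (elim y)
      then show ?case using side_neg_iff[of y p] p by force
    qed
  next
    fix a assume a: "contact x < a"
    define p where "p = min ((a + contact x) / 2) (contact x + e / 2)"
    have "contact x < p" "p < contact x + e" using a e by (simp_all add: p_def min_less_iff_disj)
    then have "p \<in> ball (contact x) e" by (simp add: dist_real_def)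
    then have p: "p \<in> active" "p < a" "contact x < p" using e a by (auto simp: p_def min_less_iff_disj)
    then have "side p x < 0" using side_neg_iff[OF x p(1)] by simp
    then have "\<forall>\<^sub>F y in at x. side p y < 0"
      using order_tendstoD(2)[OF lim] by blast
    with nhd show "\<forall>\<^sub>F y in at x. contact y < a"
    proof eventually_elim
      case (elim y)
      then show ?case using side_neg_iff[of y p] p by force
    qed
  }
qed

end

subsection \<open>The convex hull and its gradient\<close>

lemma GDERIV_unique:
  assumes "GDERIV f x :> D" "GDERIV f x :> D'"
  shows "D = D'"
proof -
  have "(\<lambda>h. h \<bullet> D) = (\<lambda>h. h \<bullet> D')"
    using assms unfolding gderiv_def by (rule has_derivative_unique)
  then show ?thesis by (metis vector_eq_ldot)
qed

lemma gradient_eqI: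
  assumes "GDERIV f x :> D"
  shows "gradient f x = D"
  unfolding gradient_def using someI[of "\<lambda>D. GDERIV f x :> D"] assms GDERIV_unique by blast

text \<open>The inequalities at \<open>x\<close> and at \<open>y\<close> trap the first-order error
  between 0 and \<open>(P y - P x) \<bullet> (y - x)\<close>; continuity of the subgradient field
  does the rest.\<close>

lemma GDERIV_if_isCont_subgradient:
  fixes f :: "'a::real_inner \<Rightarrow> real"
  assumes S: "open S" "x \<in> S" and sub: "\<And>y z. y \<in> S \<Longrightarrow> z \<in> S \<Longrightarrow> f y + P y \<bullet> (z - y) \<le> f z"
    and cont: "isCont P x"
  shows "GDERIV f x :> P x"
  unfolding gderiv_def has_derivative_iff_norm
proof (intro conjI bounded_linear_inner_left)
  have "\<forall>\<^sub>F y in at x. y \<in> S"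
    using S by (rule eventually_at_in_open')
  then have "\<forall>\<^sub>F y in at x. norm (norm (f y - f x - (y - x) \<bullet> P x) / norm (y - x)) \<le> norm (P y - P x)"
  proof eventually_elim
    case (elim y)
    have "f x + P x \<bullet> (y - x) \<le> f y" "f y + P y \<bullet> (x - y) \<le> f x"
      using sub S elim by auto
    then have "\<bar>f y - f x - (y - x) \<bullet> P x\<bar> \<le> (P y - P x) \<bullet> (y - x)"
      by (simp add: inner_diff_left inner_diff_right inner_commute)
    also have "\<dots> \<le> norm (P y - P x) * norm (y - x)"
      by (rule norm_cauchy_schwarz)
    finally show ?case by (cases "y = x") (simp_all add: divide_le_eq)
  qed
  moreover have "((\<lambda>y. norm (P y - P x)) \<longlongrightarrow> 0) (at x)"
    using cont by (simp add: isCont_def tendsto_norm_zero_iff LIM_zero_iff)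
  ultimately show "((\<lambda>y. norm (f y - f x - (y - x) \<bullet> P x) / norm (y - x)) \<longlongrightarrow> 0) (at x)"
    by (rule Lim_null_comparison)
qed

section \<open>Epigraphs, supporting planes and the hull\<close>

lemma conjugate_fun_le_iff: "conjugate_fun v y \<le> ereal t \<longleftrightarrow> (\<forall>p. p * y - v p \<le> t)"
  by (simp add: conjugate_fun_def SUP_le_iff)

lemma epi_extend_conjugate:
  "epi (extend_to_plane (conjugate_fun v)) = {(x, t). snd x = 0 \<and> (\<forall>p. p * fst x - v p \<le> t)}"
  by (auto simp: epi_def extend_to_plane_def conjugate_fun_le_iff split: if_splits)

lemma epi_indicator: "epi (indicator_fun S) = {(x, t). x \<in> S \<and> 0 \<le> t}"
  by (auto simp: epi_def indicator_fun_def split: if_splits)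

definition unit_disc :: "(real \<times> real) set"
  where "unit_disc = {x. (fst x)\<^sup>2 + (snd x)\<^sup>2 \<le> 1}"

lemma unit_disc_eq_cball: "unit_disc = cball 0 1"
  by (auto simp: unit_disc_def norm_Pair norm_prod_def)

context profile
begin

definition hull_fun :: "real \<times> real \<Rightarrow> ereal"
  where "hull_fun = conv_fun (indicator_fun unit_disc) (extend_to_plane (conjugate_fun v))"

text \<open>For \<open>e = 1\<close> or \<open>e = -1\<close> the gradient has norm
  \<open>v p\<close>, so the maximum over the disc is 0; on the axis the plane is
  \<open>p * y - v p\<close>, a minorant of the conjugate. Hence it lies below both
  functions.\<close>

definition plane_fun :: "real \<Rightarrow> real \<Rightarrow> real \<times> real \<Rightarrow> real"
  where "plane_fun p e x = (p, e * sqrt ((v p)\<^sup>2 - p\<^sup>2)) \<bullet> x - v p"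

lemma norm_supporting: "\<bar>e\<bar> = 1 \<Longrightarrow> (norm (p, e * sqrt ((v p)\<^sup>2 - p\<^sup>2)))\<^sup>2 = (v p)\<^sup>2"
  using sq_le[of p] power2_abs[of e] by (simp add: norm_Pair power_mult_distrib)

lemma plane_fun_le_0:
  assumes "\<bar>e\<bar> = 1" "x \<in> unit_disc"
  shows "plane_fun p e x \<le> 0"
proof -
  have "norm (p, e * sqrt ((v p)\<^sup>2 - p\<^sup>2)) = v p"
    by (rule power2_eq_imp_eq[OF norm_supporting[OF assms(1)]]) (use v_pos[of p] in simp_all)
  moreover have "norm x \<le> 1" using assms by (simp add: unit_disc_eq_cball)
  moreover have "v p * norm x \<le> v p * 1"
    using v_pos[of p] \<open>norm x \<le> 1\<close> by (intro mult_left_mono) auto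
  ultimately show ?thesis
    using norm_cauchy_schwarz[of "(p, e * sqrt ((v p)\<^sup>2 - p\<^sup>2))" x]
    by (simp add: plane_fun_def)
qed

lemma conjugate_dom:
  assumes "\<And>p. p * y - v p \<le> t"
  shows "\<bar>y\<bar> \<le> 1"
proof (rule ccontr)
  assume "\<not> \<bar>y\<bar> \<le> 1"
  then have y: "\<bar>y\<bar> - 1 > 0" by simp
  \<comment> \<open>Testing at \<open>sgn y * r\<close> bounds \<open>(|y| - 1) * r\<close> by
    \<open>t + M\<close>, which this choice exceeds.\<close>
  define r where "r = (\<bar>t\<bar> + M + 1) / (\<bar>y\<bar> - 1)"
  have r: "r > 0" using y M_pos by (simp add: r_def add_nonneg_pos)
  have "sgn y * r * y - v (sgn y * r) \<le> t" by (rule assms)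
  moreover have "v (sgn y * r) \<le> r + M"
    using upper[of "sgn y * r"] r y by (auto simp: abs_mult sgn_if split: if_splits)
  moreover have "sgn y * r * y = \<bar>y\<bar> * r" by (simp add: abs_sgn mult_ac)
  ultimately have "\<bar>y\<bar> * r \<le> t + r + M" by linarith
  then have "(\<bar>y\<bar> - 1) * r \<le> t + M" by (simp add: algebra_simps)
  then show False using y by (simp add: r_def)
qed

text \<open>The points over the disc and above the plane form a convex set containing both
  epigraphs. This yields the effective domain as well as all lower bounds.\<close>

lemma hull_subset:
  assumes "\<bar>e\<bar> = 1"
    and "(x, t) \<in> convex hull (epi (indicator_fun unit_disc) \<union> epi (extend_to_plane (conjugate_fun v)))"
  shows "x \<in> unit_disc" "plane_fun p e x \<le> t"
proof -
  let ?S = "{z. plane_fun p e (fst z) - snd z \<le> 0} \<inter> unit_disc \<times> (UNIV :: real set)"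
  have "convex {z :: (real \<times> real) \<times> real. ((p, e * sqrt ((v p)\<^sup>2 - p\<^sup>2)), -1) \<bullet> z \<le> v p}"
    by (rule convex_halfspace_le)
  then have "convex {z. plane_fun p e (fst z) - snd z \<le> 0}"
    by (simp add: plane_fun_def inner_Pair inner_prod_def algebra_simps)
  then have "convex ?S"
    by (intro convex_Int convex_Times) (auto simp: unit_disc_eq_cball)
  moreover have "epi (indicator_fun unit_disc) \<subseteq> ?S"
  proof
    fix z assume "z \<in> epi (indicator_fun unit_disc)"
    then show "z \<in> ?S"
      using plane_fun_le_0[OF assms(1), of "fst z" p] by (auto simp: epi_indicator)
  qed
  moreover have "epi (extend_to_plane (conjugate_fun v)) \<subseteq> ?S"
  proof
    fix z assume "z \<in> epi (extend_to_plane (conjugate_fun v))"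
    then obtain y t where z: "z = ((y, 0), t)" and *: "p * y - v p \<le> t" for p
      by (auto simp: epi_extend_conjugate)
    have "\<bar>y\<bar> \<le> 1" using * by (rule conjugate_dom)
    then have "(y, 0) \<in> unit_disc" by (simp add: unit_disc_def abs_square_le_1)
    then show "z \<in> ?S" using *[of p] by (simp add: z plane_fun_def)
  qed
  ultimately have "convex hull (epi (indicator_fun unit_disc) \<union> epi (extend_to_plane (conjugate_fun v))) \<subseteq> ?S"
    by (intro hull_minimal) auto
  with assms(2) show "x \<in> unit_disc" "plane_fun p e x \<le> t" by auto
qed

lemma hull_fun_le:
  assumes "(x, t) \<in> convex hull (epi (indicator_fun unit_disc) \<union> epi (extend_to_plane (conjugate_fun v)))"
  shows "hull_fun x \<le> ereal t"
  unfolding hull_fun_def conv_fun_def using assms by (intro INF_lower) auto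

lemma hull_fun_outside:
  assumes "x \<notin> unit_disc"
  shows "hull_fun x = \<infinity>"
proof -
  have "{t. (x, t) \<in> convex hull (epi (indicator_fun unit_disc) \<union> epi (extend_to_plane (conjugate_fun v)))} = {}"
    using hull_subset(1)[of 1 x] assms by auto
  then show ?thesis by (simp add: hull_fun_def conv_fun_def top_ereal_def)
qed

lemma hull_fun_le_0: "x \<in> unit_disc \<Longrightarrow> hull_fun x \<le> 0"
  using hull_fun_le[of x 0] by (auto simp: epi_indicator zero_ereal_def intro: hull_inc)

lemma eff_dom_hull_fun: "eff_dom hull_fun = unit_disc"
  using hull_fun_outside hull_fun_le_0 by (force simp: eff_dom_def)

lemma plane_fun_le_hull_fun: "\<bar>e\<bar> = 1 \<Longrightarrow> ereal (plane_fun p e x) \<le> hull_fun x"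
  unfolding hull_fun_def conv_fun_def using hull_subset(2)[of e x] by (intro INF_greatest) auto

abbreviation profile_fun :: "real \<times> real \<Rightarrow> real"
  where "profile_fun x \<equiv> real_of_ereal (hull_fun x)"

lemma ereal_profile_fun: "x \<in> unit_disc \<Longrightarrow> ereal (profile_fun x) = hull_fun x"
  using hull_fun_le_0[of x] plane_fun_le_hull_fun[of 1 0 x] by (cases "hull_fun x") auto

lemma profile_fun_ge: "\<bar>e\<bar> = 1 \<Longrightarrow> x \<in> unit_disc \<Longrightarrow> plane_fun p e x \<le> profile_fun x"
  using plane_fun_le_hull_fun[of e p x] ereal_profile_fun[of x] by (metis ereal_less_eq(3))

lemma half_discs_subset: "half_discs \<subseteq> unit_disc"
  by (auto simp: half_discs_def unit_disc_def)

text \<open>The chord joins a point of the graph of \<open>conjugate_fun v\<close> to the unit circle,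
  where \<open>hull_fun\<close> vanishes; along it the supporting plane interpolates the two values.\<close>
lemma profile_fun_on_chord:
  assumes "on_chord p m x" "x \<in> half_discs"
  shows "profile_fun x = plane_fun p (sgn (snd x)) x"
proof -
  obtain t where t: "0 < t" "t < 1" "fst x = (1 - t) * m + t * cosine p" "\<bar>snd x\<bar> = t * sine p"
    using on_chord_point assms by blast
  have e: "\<bar>sgn (snd x)\<bar> = 1" using assms by (simp add: half_discs_def abs_sgn_eq)
  have m: "subgradient v p m" using assms by (simp add: on_chord_def)
  let ?e = "sgn (snd x)"
  let ?E = "epi (indicator_fun unit_disc) \<union> epi (extend_to_plane (conjugate_fun v))"
  \<comment> \<open>Equality case of Fenchel's inequality: a subgradient \<open>m\<close> at
    \<open>p\<close> makes \<open>p\<close> a maximiser, so the conjugate at \<open>m\<close> is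
    \<open>p * m - v p\<close>.\<close>
  have "q * m - v q \<le> p * m - v p" for q
    using m by (auto simp: subgradient_def algebra_simps dest: spec[of _ q])
  then have 1: "((m, 0), p * m - v p) \<in> ?E" by (simp add: epi_extend_conjugate)
  have "?e\<^sup>2 = 1" using e by (metis power2_abs power_one)
  then have 2: "((cosine p, ?e * sine p), 0) \<in> ?E"
    using cosine_sine[of p] by (simp add: epi_indicator unit_disc_def power_mult_distrib)
  have "(1 - t) *\<^sub>R ((m, 0), p * m - v p) + t *\<^sub>R ((cosine p, ?e * sine p), 0) \<in> convex hull ?E"
    using t 1 2 by (intro convexD[OF convex_convex_hull] hull_inc) auto
  moreover have "t * (?e * sine p) = snd x"
    using t(4) by (metis mult.left_commute mult_sgn_abs)
  then have "(1 - t) *\<^sub>R ((m, 0), p * m - v p) + t *\<^sub>R ((cosine p, ?e * sine p), 0) = (x, (1 - t) * (p * m - v p))"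
    using t(3) by (cases x) simp
  ultimately have "(x, (1 - t) * (p * m - v p)) \<in> convex hull ?E" by simp
  then have "hull_fun x \<le> ereal ((1 - t) * (p * m - v p))" by (rule hull_fun_le)
  then have "profile_fun x \<le> (1 - t) * (p * m - v p)"
    using ereal_profile_fun[of x] half_discs_subset assms by (metis ereal_less_eq(3) subsetD)
  also have "\<dots> = plane_fun p ?e x"
  proof -
    \<comment> \<open>This says that the plane vanishes at the circle end of the chord.\<close>
    have "p * cosine p + sqrt ((v p)\<^sup>2 - p\<^sup>2) * sine p = v p"
      using v_pos[of p] sq_le[of p] by (simp add: cosine_def sine_def divide_simps) (simp add: power2_eq_square)
    then have *: "t * (p * cosine p) + sqrt ((v p)\<^sup>2 - p\<^sup>2) * (t * sine p) = t * v p"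
      by (metis (no_types, opaque_lifting) distrib_left mult.left_commute)
    have "plane_fun p ?e x = p * fst x + sqrt ((v p)\<^sup>2 - p\<^sup>2) * \<bar>snd x\<bar> - v p"
      by (simp add: plane_fun_def inner_prod_def abs_sgn mult_ac)
    also have "\<dots> = (1 - t) * (p * m) + (t * (p * cosine p) + sqrt ((v p)\<^sup>2 - p\<^sup>2) * (t * sine p)) - v p"
      unfolding t(3,4) by (simp add: algebra_simps)
    finally show ?thesis unfolding * by (simp add: algebra_simps)
  qed
  finally show ?thesis
    using profile_fun_ge[OF e, of x p] half_discs_subset assms by auto
qed

text \<open>The supporting planes touch \<open>profile_fun\<close> at their own points and lie below
  it on the whole disc, so their gradients are subgradients even between points of opposite
  half-discs. They vary continuously because \<open>contact\<close> does and \<open>snd x\<close> is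
  nonzero.\<close>

lemma norm_gradient_profile_fun:
  assumes x: "x \<in> half_discs"
  shows "(norm (gradient profile_fun x))\<^sup>2 = (v (contact x))\<^sup>2"
proof -
  define P where "P y = (contact y, sgn (snd y) * sqrt ((v (contact y))\<^sup>2 - (contact y)\<^sup>2))" for y
  have e: "\<bar>sgn (snd y)\<bar> = 1" if "y \<in> half_discs" for y :: "real \<times> real"
    using that by (simp add: half_discs_def abs_sgn_eq)
  have "GDERIV profile_fun x :> P x"
  proof (rule GDERIV_if_isCont_subgradient[OF open_half_discs x])
    fix y z assume yz: "y \<in> half_discs" "z \<in> half_discs"
    obtain m where "on_chord (contact y) m y" using on_chord_contact yz by blast
    then have "profile_fun y = plane_fun (contact y) (sgn (snd y)) y"
      using yz by (intro profile_fun_on_chord)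
    then have "profile_fun y + P y \<bullet> (z - y) = plane_fun (contact y) (sgn (snd y)) z"
      by (simp add: P_def plane_fun_def inner_diff_right)
    also have "\<dots> \<le> profile_fun z"
      using yz half_discs_subset e by (intro profile_fun_ge) auto
    finally show "profile_fun y + P y \<bullet> (z - y) \<le> profile_fun z" .
  next
    have "isCont (\<lambda>y. v (contact y)) x"
      using isCont_o2[OF isCont_contact[OF x] isCont_v] .
    then show "isCont P x"
      unfolding P_def using x
      by (intro continuous_intros isCont_contact[OF x]) (auto simp: half_discs_def)
  qed
  then have "gradient profile_fun x = P x" by (rule gradient_eqI)
  then show ?thesis using norm_supporting[OF e[OF x]] by (simp add: P_def)
qed

end

subsection \<open>Layer-cake integration over the disc\<close>

lemma set_integrable_Icc_bounded:
  fixes f :: "real \<Rightarrow> real"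
  assumes f: "f \<in> borel_measurable borel" and B: "\<And>x. x \<in> {a..b} \<Longrightarrow> \<bar>f x\<bar> \<le> B"
  shows "set_integrable lborel {a..b} f"
  unfolding set_integrable_def
proof (rule Bochner_Integration.integrable_bound)
  show "integrable lborel (\<lambda>x. indicator {a..b} x * B)"
    by (intro integrable_mult_left integrable_real_indicator) (auto simp: emeasure_lborel_Icc_eq)
  show "AE x in lborel. norm (indicator {a..b} x *\<^sub>R f x) \<le> norm (indicator {a..b} x * B)"
    using B by (intro AE_I2) (auto simp: indicator_def intro: order_trans[OF _ abs_ge_self])
qed (use f in measurable)

context profile
begin

definition weight :: "real \<Rightarrow> real"
  where "weight p = 1 / (1 + (v p)\<^sup>2)"

definition weight_slope :: "real \<Rightarrow> real"
  where "weight_slope p = - (2 * v p * slope p) / (1 + (v p)\<^sup>2)\<^sup>2"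

lemma weight_bounds: "0 < weight p" "weight p \<le> 1"
  by (simp_all add: weight_def add_pos_nonneg divide_le_eq)

lemma continuous_weight: "continuous_on A weight"
  unfolding weight_def
  by (intro continuous_intros continuous_v) (auto simp: add_nonneg_eq_0_iff)

lemma v_has_right_derivative: "(v has_real_derivative slope p) (at_right p)"
  using conv by (rule right_slope_has_derivative)

lemma weight_has_right_derivative: "(weight has_real_derivative weight_slope p) (at_right p)"
proof -
  have nz: "1 + (v p)\<^sup>2 \<noteq> 0" by (simp add: add_nonneg_eq_0_iff)
  have "((\<lambda>p. 1 / (1 + (v p)\<^sup>2)) has_real_derivative
      (0 * (1 + (v p)\<^sup>2) - 1 * (0 + of_nat 2 * (slope p * v p ^ (2 - Suc 0)))) / ((1 + (v p)\<^sup>2) * (1 + (v p)\<^sup>2)))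
      (at_right p)"
    by (intro DERIV_divide DERIV_add DERIV_const DERIV_power v_has_right_derivative nz)
  then show ?thesis
    by (simp add: weight_def[abs_def] weight_slope_def power2_eq_square mult_ac)
qed

lemma weight_slope_bound: "\<bar>weight_slope p\<bar> \<le> 1"
proof -
  have "2 * v p * 1 \<le> 1 + (v p)\<^sup>2"
    using zero_le_power2[of "v p - 1"] by (simp add: power2_eq_square algebra_simps)
  moreover have "\<bar>2 * v p * slope p\<bar> \<le> 2 * v p * 1"
    using slope_bound[of p] v_pos[of p] by (simp add: abs_mult mult_left_le)
  moreover have "1 + (v p)\<^sup>2 \<le> (1 + (v p)\<^sup>2)\<^sup>2"
    by (rule self_le_power) auto
  ultimately show ?thesis
    by (simp add: weight_slope_def abs_divide divide_le_eq)
qed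

lemma borel_slope [measurable]: "slope \<in> borel_measurable borel"
  using conv by (intro borel_measurable_mono mono_right_slope)

lemma borel_v [measurable]: "v \<in> borel_measurable borel"
  by (intro borel_measurable_continuous_onI continuous_v)

lemma borel_weight [measurable]: "weight \<in> borel_measurable borel"
  by (intro borel_measurable_continuous_onI continuous_weight)

lemma borel_cosine [measurable]: "cosine \<in> borel_measurable borel"
  by (intro borel_measurable_continuous_onI continuous_cosine)

lemma borel_sine [measurable]: "sine \<in> borel_measurable borel"
  by (intro borel_measurable_continuous_onI continuous_sine)

lemma borel_weight_slope [measurable]: "weight_slope \<in> borel_measurable borel"
  unfolding weight_slope_def[abs_def] by measurable

lemma integral_weight_slope: "a \<le> b \<Longrightarrow> (LINT p:{a..b}|lborel. weight_slope p) = weight b - weight a"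
  by (rule fundamental_theorem_right_derivative[where B = 1])
    (auto intro: continuous_weight weight_has_right_derivative weight_slope_bound)

text \<open>Truncation to a compact interval of active parameters keeps the denominators
  \<open>sqrt ((v p)\<^sup>2 - p\<^sup>2)\<close> away from zero.\<close>

abbreviation clamp_contact :: "real \<Rightarrow> real \<Rightarrow> real \<times> real \<Rightarrow> real"
  where "clamp_contact a b x \<equiv> max a (min b (contact x))"

text \<open>The weight is recovered by integrating its derivative from the clamped parameter up to
  \<open>b\<close>; almost everywhere, the condition that \<open>p\<close> exceeds
  \<open>contact x\<close> is the sign condition \<open>side p x < 0\<close>.\<close>

lemma weight_clamp_contact:
  assumes "a \<le> b" "{a..b} \<subseteq> active" "x \<in> half_discs"
  shows "weight (clamp_contact a b x) =
    weight b - (LINT p|lborel. indicator {a..b} p * (if side p x < 0 then weight_slope p else 0))"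
proof -
  let ?h = "clamp_contact a b x"
  have "(LINT p|lborel. indicator {a..b} p * (if side p x < 0 then weight_slope p else 0))
    = (LINT p:{?h..b}|lborel. weight_slope p)"
    unfolding set_lebesgue_integral_def
  proof (rule integral_cong_AE)
    show "AE p in lborel. indicator {a..b} p * (if side p x < 0 then weight_slope p else 0) =
        indicator {?h..b} p *\<^sub>R weight_slope p"
      \<comment> \<open>The sign is undetermined at \<open>contact x\<close>. The point
        \<open>b\<close> is dropped because for \<open>contact x > b\<close> the interval
        degenerates to \<open>{b}\<close>, where \<open>side\<close> is positive.\<close>
      using AE_lborel_singleton[of "contact x"] AE_lborel_singleton[of b]
    proof eventually_elim
      case (elim p)
      show ?case
      proof (cases "p \<in> {a..b}")
        case True
        then have "side p x < 0 \<longleftrightarrow> contact x < p"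
          using side_neg_iff[of x p] assms elim by auto
        then show ?thesis using True elim by (auto simp: indicator_def)
      qed (use \<open>a \<le> b\<close> in \<open>auto simp: indicator_def\<close>)
    qed
    show "(\<lambda>p. indicator {a..b} p * (if side p x < 0 then weight_slope p else 0)) \<in> borel_measurable lborel"
      unfolding side_def chord_side_def by measurable
  qed measurable
  also have "\<dots> = weight b - weight ?h"
    using assms by (intro integral_weight_slope) auto
  finally show ?thesis by simp
qed

lemma AE_snd_nonzero: "AE x :: real \<times> real in lborel. snd x \<noteq> 0"
proof -
  have "negligible {x :: real \<times> real. (0, 1) \<bullet> x = 0}"
    by (rule negligible_hyperplane) (simp add: zero_prod_def)
  then have "AE x :: real \<times> real in lebesgue. x \<notin> {x. (0, 1) \<bullet> x = 0}"
    by (intro AE_not_in) (simp add: negligible_iff_null_sets)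
  then show ?thesis by (simp add: AE_completion_iff inner_prod_def)
qed

lemma measure_side_neg:
  assumes "p \<in> active"
  shows "(LINT x|lborel. indicator open_disc x * (if side p x < 0 then 1 else 0 :: real)) =
    pi - arccos (cosine p) + slope p * sine p"
proof -
  have "(LINT x|lborel. indicator open_disc x * (if side p x < 0 then 1 else 0 :: real)) =
      (LINT x|lborel. indicator {x \<in> open_disc. side p x < 0} x)"
    by (intro Bochner_Integration.integral_cong) (auto simp: indicator_def)
  also have "\<dots> = pi - arccos (cosine p) + slope p * sine p"
    unfolding side_def using measure_chord_side_neg[OF cosine_sine sine_pos[OF assms] slope_bound] by simp
  finally show ?thesis .
qed

lemma measure_open_disc: "measure lborel open_disc = pi"
proof -
  have "fst x < 1" if "x \<in> open_disc" for x :: "real \<times> real"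
  proof -
    have "(fst x)\<^sup>2 < 1" using that zero_le_power2[of "snd x"] unfolding open_disc_def mem_Collect_eq by linarith
    then show ?thesis by (simp add: abs_square_less_1 abs_less_iff)
  qed
  then have "{x \<in> open_disc. fst x < 1} = open_disc" by auto
  then show ?thesis using measure_disc_left_of[of 1] by simp
qed

section \<open>The truncated disc integral and the arc density\<close>

definition mean_weight :: "real \<Rightarrow> real \<Rightarrow> real"
  where "mean_weight a b = (LINT x|lborel. indicator half_discs x * weight (clamp_contact a b x))"

text \<open>Fubini against the areas of the regions \<open>side p < 0\<close>.\<close>
lemma mean_weight_eq:
  assumes ab: "a \<le> b" "{a..b} \<subseteq> active"
  shows "mean_weight a b = pi * weight b -
    (LINT p:{a..b}|lborel. weight_slope p * (pi - arccos (cosine p) + slope p * sine p))"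
proof -
  define f where "f x p = indicator open_disc x * (indicator {a..b} p * (if side p x < 0 then weight_slope p else 0))"
    for x p
  have [measurable]: "case_prod f \<in> borel_measurable (lborel \<Otimes>\<^sub>M lborel)"
  proof -
    let ?M = "lborel \<Otimes>\<^sub>M lborel :: ((real \<times> real) \<times> real) measure"
    define X Y where "X z = fst (fst z)" and "Y z = snd (fst z)" for z :: "(real \<times> real) \<times> real"
    have [measurable]: "X \<in> borel_measurable ?M" "Y \<in> borel_measurable ?M"
      unfolding X_def[abs_def] Y_def[abs_def] lborel_prod measurable_lborel2
      by (intro borel_measurable_continuous_onI continuous_intros)+
    have "case_prod f = (\<lambda>z. indicator open_disc (fst z) * (indicator {a..b} (snd z) *
        (if sine (snd z) * (X z - slope (snd z)) - (cosine (snd z) - slope (snd z)) * \<bar>Y z\<bar> < 0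
         then weight_slope (snd z) else 0)))"
      by (auto simp: f_def side_def chord_side_def X_def Y_def)
    also have "\<dots> \<in> borel_measurable ?M" by measurable
    finally show ?thesis .
  qed
  have int: "integrable (lborel \<Otimes>\<^sub>M lborel) (case_prod f)"
  proof (rule Bochner_Integration.integrable_bound)
    have "emeasure (lborel \<Otimes>\<^sub>M lborel) (open_disc \<times> {a..b}) < \<infinity>"
      using fmeasurable_open_disc
      by (subst lborel.emeasure_pair_measure_Times)
         (auto simp: fmeasurable_def ennreal_mult_less_top emeasure_lborel_Icc_eq)
    then show "integrable (lborel \<Otimes>\<^sub>M lborel) (indicator (open_disc \<times> {a..b}) :: _ \<Rightarrow> real)"
      by (intro integrable_real_indicator) auto
    show "AE z in lborel \<Otimes>\<^sub>M lborel. norm (case_prod f z) \<le> norm (indicator (open_disc \<times> {a..b}) z :: real)"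
      using weight_slope_bound by (intro AE_I2) (auto simp: f_def indicator_def)
  qed measurable
  have "mean_weight a b = (LINT x|lborel. indicator open_disc x * weight b - (LINT p|lborel. f x p))"
    unfolding mean_weight_def
  proof (rule integral_cong_AE)
    show "AE x in lborel. indicator half_discs x * weight (clamp_contact a b x) =
        indicator open_disc x * weight b - (LINT p|lborel. f x p)"
      using AE_snd_nonzero
    proof eventually_elim
      case (elim x)
      then have "x \<in> half_discs \<longleftrightarrow> x \<in> open_disc" by (simp add: half_discs_def open_disc_def)
      then show ?case
        using weight_clamp_contact[OF ab, of x] by (cases "x \<in> open_disc") (simp_all add: f_def)
    qed
    have "continuous_on half_discs (\<lambda>x. weight (clamp_contact a b x))"
      using isCont_contact by (intro continuous_on_compose2[OF continuous_weight[of UNIV]] continuous_intros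
        continuous_at_imp_continuous_on) auto
    then show "(\<lambda>x. indicator half_discs x * weight (clamp_contact a b x)) \<in> borel_measurable lborel"
      using borel_measurable_continuous_on_indicator[of half_discs "\<lambda>x. weight (clamp_contact a b x)"]
        open_half_discs by simp
    show "(\<lambda>x. indicator open_disc x * weight b - (LINT p|lborel. f x p)) \<in> borel_measurable lborel"
      by measurable
  qed
  also have "\<dots> = (LINT x|lborel. indicator open_disc x * weight b) - (LINT x|lborel. LINT p|lborel. f x p)"
    using lborel_pair.integrable_fst[OF int] fmeasurable_open_disc
    by (intro Bochner_Integration.integral_diff integrable_mult_left integrable_real_indicator)
      (auto simp: fmeasurable_def)
  also have "(LINT x|lborel. indicator open_disc x * weight b) = pi * weight b"
    using measure_open_disc by simp
  also have "(LINT x|lborel. LINT p|lborel. f x p) = (LINT p|lborel. LINT x|lborel. f x p)"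
    using lborel_pair.Fubini_integral[OF int] by simp
  also have "\<dots> = (LINT p:{a..b}|lborel. weight_slope p * (pi - arccos (cosine p) + slope p * sine p))"
    unfolding set_lebesgue_integral_def
  proof (intro Bochner_Integration.integral_cong refl)
    fix p
    show "(LINT x|lborel. f x p) = indicator {a..b} p *\<^sub>R (weight_slope p * (pi - arccos (cosine p) + slope p * sine p))"
    proof (cases "p \<in> {a..b}")
      case True
      then have "f x p = weight_slope p * (indicator open_disc x * (if side p x < 0 then 1 else 0 :: real))" for x
        by (simp add: f_def)
      then show ?thesis using True ab measure_side_neg[of p] by auto
    qed (simp add: f_def)
  qed
  finally show ?thesis .
qed

definition arc_density :: "real \<Rightarrow> real"
  where "arc_density p = 2 * sqrt ((v p)\<^sup>2 - p\<^sup>2) * (slope p)\<^sup>2 / (1 + (v p)\<^sup>2)\<^sup>2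
    - (p * slope p - v p) / (v p * (1 + (v p)\<^sup>2) * sqrt ((v p)\<^sup>2 - p\<^sup>2))"

text \<open>Because of this sign, a limit of integrals over compact intervals gives integrability on
  all of \<open>active\<close>.\<close>

lemma arc_density_nonneg: "0 \<le> arc_density p"
proof -
  have "p * slope p \<le> \<bar>p\<bar> * \<bar>slope p\<bar>" by (metis abs_ge_self abs_mult)
  also have "\<dots> \<le> \<bar>p\<bar> * 1" using slope_bound by (intro mult_left_mono) auto
  finally have "p * slope p - v p \<le> 0" using lower[of p] by simp
  moreover have "0 \<le> v p * (1 + (v p)\<^sup>2) * sqrt ((v p)\<^sup>2 - p\<^sup>2)"
    using v_pos[of p] sq_le[of p] by simp
  ultimately have "(p * slope p - v p) / (v p * (1 + (v p)\<^sup>2) * sqrt ((v p)\<^sup>2 - p\<^sup>2)) \<le> 0"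
    by (rule divide_nonpos_nonneg)
  moreover have "0 \<le> 2 * sqrt ((v p)\<^sup>2 - p\<^sup>2) * (slope p)\<^sup>2 / (1 + (v p)\<^sup>2)\<^sup>2"
    using sq_le[of p] by simp
  ultimately show ?thesis by (simp add: arc_density_def)
qed

lemma borel_arc_density [measurable]: "arc_density \<in> borel_measurable borel"
  unfolding arc_density_def[abs_def] by measurable

text \<open>The two subtracted terms are the areas \<open>arccos (cosine b)\<close> and
  \<open>pi - arccos (cosine a)\<close> of the circular sectors cut off at the ends, times the
  boundary weights.\<close>

lemma integral_arc_density:
  assumes ab: "a \<le> b" "{a..b} \<subseteq> active"
  shows "set_integrable lborel {a..b} arc_density" (is ?int)
    and "(LINT p:{a..b}|lborel. arc_density p) =
      mean_weight a b - weight b * arccos (cosine b) - weight a * (pi - arccos (cosine a))" (is ?eq)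
proof -
  let ?q = "\<lambda>p. sqrt ((v p)\<^sup>2 - p\<^sup>2)"
  txt \<open>\<open>W\<close> is the contribution of the circular sectors; its derivative and the layer-cake integrand
    \<open>A\<close> differ exactly by \<open>arc_density\<close>.\<close>
  define W where "W p = weight p * (pi - arccos (cosine p))" for p
  define W' where "W' p = weight_slope p * (pi - arccos (cosine p)) + weight p * ((v p - p * slope p) / (v p * ?q p))" for p
  define A where "A p = weight_slope p * (pi - arccos (cosine p) + slope p * sine p)" for p
  have act: "p \<in> active" if "p \<in> {a..b}" for p using ab that by auto
  have cos: "-1 \<le> cosine p" "cosine p \<le> 1" for p
    using lower[of p] v_pos[of p] by (auto simp: cosine_def divide_simps abs_le_iff)
  have arccos_bd: "0 \<le> arccos (cosine p)" "arccos (cosine p) \<le> pi" for p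
    using cos by (auto intro: arccos_lbound arccos_ubound)
  have cont_arccos: "continuous_on T (\<lambda>p. arccos (cosine p))" for T
    using cos by (intro continuous_on_compose2[OF continuous_on_arccos'] continuous_cosine) auto
  have [measurable]: "(\<lambda>p. arccos (cosine p)) \<in> borel_measurable borel"
    by (intro borel_measurable_continuous_onI cont_arccos)
  have dW: "(W has_real_derivative W' p) (at_right p)" if p: "p \<in> active" for p
  proof -
    have q: "?q p > 0" "v p > 0" using sqrt_pos[OF p] v_pos by auto
    have s: "sqrt (1 - (cosine p)\<^sup>2) = ?q p / v p"
      using cosine_sine[of p] sine_pos[OF p] by (intro real_sqrt_unique) (auto simp: sine_def)
    have "(cosine has_real_derivative (1 * v p - p * slope p) / (v p * v p)) (at_right p)"
      unfolding cosine_def[abs_def] using q by (intro DERIV_divide DERIV_ident v_has_right_derivative) simp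
    from DERIV_chain2[OF DERIV_arccos this] cosine_bounds[OF p]
    have "((\<lambda>p. arccos (cosine p)) has_real_derivative
        inverse (- (?q p / v p)) * ((v p - p * slope p) / (v p * v p))) (at_right p)"
      by (simp add: s)
    also have "inverse (- (?q p / v p)) * ((v p - p * slope p) / (v p * v p)) = - ((v p - p * slope p) / (v p * ?q p))"
      using q by (simp add: field_simps)
    finally have "((\<lambda>p. arccos (cosine p)) has_real_derivative - ((v p - p * slope p) / (v p * ?q p))) (at_right p)" .
    then have "(W has_real_derivative
        weight_slope p * (pi - arccos (cosine p)) + (0 - - ((v p - p * slope p) / (v p * ?q p))) * weight p) (at_right p)"
      unfolding W_def[abs_def] by (intro DERIV_mult DERIV_diff DERIV_const weight_has_right_derivative)
    then show ?thesis by (simp add: W'_def mult.commute)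
  qed
  \<comment> \<open>\<open>W'\<close> may jump with \<open>slope\<close>, so compactness is applied
    to the continuous majorant \<open>?K\<close>.\<close>
  obtain B where B: "\<bar>W' p\<bar> \<le> B" if "p \<in> {a..b}" for p
  proof -
    let ?K = "\<lambda>p. pi + (v p + \<bar>p\<bar>) / (v p * ?q p)"
    have "continuous_on {a..b} ?K"
      using v_pos act sqrt_pos by (intro continuous_intros continuous_v) (force simp: less_le)
    then have "bounded (?K ` {a..b})"
      by (intro compact_imp_bounded compact_continuous_image) auto
    then obtain B where B: "\<forall>p\<in>{a..b}. \<bar>?K p\<bar> \<le> B"
      unfolding bounded_iff by auto
    have "\<bar>W' p\<bar> \<le> B" if p: "p \<in> {a..b}" for p
    proof -
      have q: "0 < v p * ?q p" using sqrt_pos[OF act[OF p]] v_pos[of p] by simp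
      have "\<bar>weight_slope p * (pi - arccos (cosine p))\<bar> \<le> 1 * pi"
        using weight_slope_bound[of p] arccos_bd[of p]
        unfolding abs_mult by (intro mult_mono) auto
      moreover have "\<bar>weight p * ((v p - p * slope p) / (v p * ?q p))\<bar> \<le> 1 * ((v p + \<bar>p\<bar>) / (v p * ?q p))"
        unfolding abs_mult
      proof (rule mult_mono)
        have "\<bar>v p - p * slope p\<bar> \<le> v p + \<bar>p\<bar> * \<bar>slope p\<bar>"
          using v_pos[of p] abs_triangle_ineq4[of "v p" "p * slope p"] by (simp add: abs_mult)
        also have "\<dots> \<le> v p + \<bar>p\<bar> * 1"
          using slope_bound by (intro add_left_mono mult_left_mono) auto
        finally show "\<bar>(v p - p * slope p) / (v p * ?q p)\<bar> \<le> (v p + \<bar>p\<bar>) / (v p * ?q p)"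
          using q by (simp add: abs_divide divide_right_mono)
      qed (use weight_bounds[of p] in auto)
      ultimately have "\<bar>W' p\<bar> \<le> ?K p"
        unfolding W'_def by linarith
      also have "\<dots> \<le> B" using B p by force
      finally show ?thesis .
    qed
    then show ?thesis by (rule that)
  qed
  have W'[measurable]: "W' \<in> borel_measurable borel" and A[measurable]: "A \<in> borel_measurable borel"
    unfolding W'_def[abs_def] A_def[abs_def] by measurable
  have "(LINT p:{a..b}|lborel. W' p) = W b - W a"
  proof (rule fundamental_theorem_right_derivative[OF \<open>a \<le> b\<close>, where B = B])
    show "continuous_on {a..b} W"
      unfolding W_def by (intro continuous_intros continuous_weight cont_arccos)
  qed (use B dW act W' in auto)
  moreover have intW: "set_integrable lborel {a..b} W'"
    using W' B by (rule set_integrable_Icc_bounded)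
  moreover have intA: "set_integrable lborel {a..b} A"
  proof (rule set_integrable_Icc_bounded[OF A])
    fix p assume p: "p \<in> {a..b}"
    have "(sine p)\<^sup>2 \<le> 1"
      using cosine_sine[of p] zero_le_power2[of "cosine p"] by linarith
    then have "\<bar>sine p\<bar> \<le> 1" by (simp add: abs_square_le_1)
    then have "\<bar>slope p * sine p\<bar> \<le> 1 * 1"
      using slope_bound[of p] unfolding abs_mult by (intro mult_mono) auto
    then have "\<bar>pi - arccos (cosine p) + slope p * sine p\<bar> \<le> pi + 1"
      using arccos_bd[of p] by linarith
    then show "\<bar>A p\<bar> \<le> 1 * (pi + 1)"
      using weight_slope_bound[of p] unfolding A_def abs_mult by (intro mult_mono) auto
  qed
  moreover have eq: "arc_density p = W' p - A p" if "p \<in> active" for p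
  proof -
    have q: "?q p > 0" "v p > 0" "1 + (v p)\<^sup>2 > 0"
      using sqrt_pos[OF that] v_pos by (auto intro: add_pos_nonneg)
    have "arc_density p = - weight_slope p * (slope p * sine p) + weight p * ((v p - p * slope p) / (v p * ?q p))"
      using q unfolding arc_density_def weight_slope_def weight_def sine_def
      by (simp add: divide_simps) (simp add: algebra_simps power2_eq_square)
    then show ?thesis by (simp add: W'_def A_def algebra_simps)
  qed
  moreover have "mean_weight a b = pi * weight b - (LINT p:{a..b}|lborel. A p)"
    unfolding mean_weight_eq[OF ab] A_def ..
  moreover have "(LINT p:{a..b}|lborel. arc_density p) = (LINT p:{a..b}|lborel. W' p - A p)"
    using eq act by (intro set_lebesgue_integral_cong) auto
  ultimately show ?eq
    by (simp add: set_integral_diff W_def algebra_simps)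
  have "set_integrable lborel {a..b} (\<lambda>p. W' p - A p)"
    using intW intA by (rule set_integral_diff)
  then show ?int
    using eq act by (subst set_integrable_cong[OF refl, where f' = "\<lambda>p. W' p - A p"]) auto
qed

section \<open>Passage to the whole interval and the whole disc\<close>

definition total_weight :: real
  where "total_weight = (LINT x|lborel. indicator half_discs x * weight (contact x))"

lemma borel_weight_contact:
  "(\<lambda>x. indicator half_discs x * weight (contact x)) \<in> borel_measurable borel"
  "(\<lambda>x. indicator half_discs x * weight (clamp_contact a b x)) \<in> borel_measurable borel"
proof -
  have "continuous_on half_discs (\<lambda>x. weight (contact x))"
    "continuous_on half_discs (\<lambda>x. weight (clamp_contact a b x))"
    using isCont_contact by (intro continuous_on_compose2[OF continuous_weight[of UNIV]] continuous_intros
      continuous_at_imp_continuous_on; simp)+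
  from this[THEN borel_measurable_continuous_on_indicator[rotated]]
  show "(\<lambda>x. indicator half_discs x * weight (contact x)) \<in> borel_measurable borel"
    "(\<lambda>x. indicator half_discs x * weight (clamp_contact a b x)) \<in> borel_measurable borel"
    using open_half_discs by simp_all
qed

lemma integrable_half_discs: "integrable lborel (indicator half_discs :: _ \<Rightarrow> real)"
proof -
  have "half_discs \<in> fmeasurable lborel"
    using open_half_discs by (intro fmeasurableI2[OF fmeasurable_open_disc]) (auto simp: half_discs_def open_disc_def)
  then show ?thesis by (auto simp: fmeasurable_def)
qed

lemma integrable_weight_contact: "integrable lborel (\<lambda>x. indicator half_discs x * weight (contact x))"
proof (rule Bochner_Integration.integrable_bound[OF integrable_half_discs])
  show "AE x in lborel. norm (indicator half_discs x * weight (contact x)) \<le> norm (indicator half_discs x :: real)"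
    using weight_bounds by (intro AE_I2) (auto simp: indicator_def less_imp_le)
qed (use borel_weight_contact in simp)

text \<open>The Lipschitz bound makes \<open>{p. v p > - p}\<close> closed upwards and
  \<open>{p. v p > p}\<close> closed downwards; openness of \<open>active\<close> makes the
  comparison with infimum and supremum strict.\<close>

lemma einterval_active:
  "einterval (INF p \<in> {p. v p > - p}. ereal p) (SUP p \<in> {p. v p > p}. ereal p) = active"
proof (intro set_eqI iffI)
  fix p assume "p \<in> einterval (INF p \<in> {p. v p > - p}. ereal p) (SUP p \<in> {p. v p > p}. ereal p)"
  then obtain a b where "- a < v a" "a < p" "b < v b" "p < b"
    by (auto simp: einterval_iff INF_less_iff less_SUP_iff)
  then show "p \<in> active"
    using lipschitz[of a p] lipschitz[of p b] by (auto simp: active_def)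
next
  fix p assume "p \<in> active"
  then obtain e where e: "e > 0" "ball p e \<subseteq> active"
    using open_active open_contains_ball by blast
  have "p - e / 2 \<in> active" "p + e / 2 \<in> active"
    using e by (auto intro!: subsetD[OF e(2)] simp: dist_real_def)
  then have "- (p - e / 2) < v (p - e / 2)" "p + e / 2 < v (p + e / 2)"
    by (auto simp: active_def abs_less_iff)
  then have "(INF p \<in> {p. v p > - p}. ereal p) \<le> ereal (p - e / 2)"
    "ereal (p + e / 2) \<le> (SUP p \<in> {p. v p > p}. ereal p)"
    by (intro INF_lower SUP_upper; simp)+
  moreover have "ereal (p - e / 2) < ereal p" "ereal p < ereal (p + e / 2)"
    using e(1) by simp_all
  ultimately show "p \<in> einterval (INF p \<in> {p. v p > - p}. ereal p) (SUP p \<in> {p. v p > p}. ereal p)"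
    unfolding einterval_iff by (metis le_less_trans less_le_trans)
qed

text \<open>Along an exhaustion by compact intervals \<open>cosine\<close> tends to -1 and 1, so the
  sector terms vanish. The integrand is allowed to differ from \<open>arc_density\<close> on a null
  set, to admit \<open>deriv v\<close> in place of the right slope.\<close>

lemma integral_arc_density_active:
  assumes ab: "a < b" "einterval a b = active"
    and f: "f \<in> borel_measurable borel" "AE p in lborel. f p = arc_density p"
  shows "set_integrable lborel (einterval a b) f" "(LBINT p=a..b. f p) = total_weight"
proof -
  obtain l u :: "nat \<Rightarrow> real" where approx: "einterval a b = (\<Union>i. {l i .. u i})"
    "incseq u" "decseq l" "\<And>i. l i < u i" "\<And>i. a < l i" "\<And>i. u i < b" "l \<longlonglongrightarrow> a" "u \<longlonglongrightarrow> b"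
    by (rule einterval_Icc_approximation[OF ab(1)]) (rule that)
  have sub: "{l i..u i} \<subseteq> active" for i using approx(1) ab(2) by auto
  then have lu: "l i \<in> active" "u i \<in> active" for i
    using approx(4)[of i] by (auto intro!: subsetD[OF sub[of i]])
  have ev: "\<forall>\<^sub>F i in sequentially. l i < p \<and> p < u i" if "p \<in> active" for p
  proof -
    have "a < ereal p" "ereal p < b" using that unfolding ab(2)[symmetric] einterval_iff by simp_all
    from order_tendstoD(2)[OF approx(7) this(1)] order_tendstoD(1)[OF approx(8) this(2)]
    show ?thesis by eventually_elim simp
  qed
  have cos_u: "(\<lambda>i. cosine (u i)) \<longlonglongrightarrow> 1"
  proof (rule order_tendstoI)
    fix k :: real assume "k < 1"
    \<comment> \<open>The maximum with 0 keeps the target in the range of \<open>cosine\<close> when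
      \<open>k \<le> -1\<close>.\<close>
    then obtain p where p: "p \<in> active" "cosine p = max k 0" using cosine_surj[of "max k 0"] by auto
    from ev[OF p(1)] show "\<forall>\<^sub>F i in sequentially. k < cosine (u i)"
    proof eventually_elim
      case (elim i)
      then show ?case using cosine_strict_mono[OF p(1) lu(2), of i] p(2) by simp
    qed
  next
    fix k :: real assume "1 < k"
    then show "\<forall>\<^sub>F i in sequentially. cosine (u i) < k"
      using cosine_bounds(2)[OF lu(2)] by (intro always_eventually allI) (rule less_trans)
  qed
  have cos_l: "(\<lambda>i. cosine (l i)) \<longlonglongrightarrow> -1"
  proof (rule order_tendstoI)
    fix k :: real assume "-1 < k"
    then obtain p where p: "p \<in> active" "cosine p = min k 0" using cosine_surj[of "min k 0"] by auto
    from ev[OF p(1)] show "\<forall>\<^sub>F i in sequentially. cosine (l i) < k"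
    proof eventually_elim
      case (elim i)
      then show ?case using cosine_strict_mono[OF lu(1) p(1), of i] p(2) by simp
    qed
  next
    fix k :: real assume "k < -1"
    then show "\<forall>\<^sub>F i in sequentially. k < cosine (l i)"
      using cosine_bounds(1)[OF lu(1)] by (intro always_eventually allI) (rule less_trans)
  qed
  have cos_bd: "-1 \<le> cosine (u i)" "cosine (u i) \<le> 1" "-1 \<le> cosine (l i)" "cosine (l i) \<le> 1" for i
    using cosine_bounds lu by (auto intro: less_imp_le)
  have "(\<lambda>i. arccos (cosine (u i))) \<longlonglongrightarrow> arccos 1" "(\<lambda>i. arccos (cosine (l i))) \<longlonglongrightarrow> arccos (-1)"
    using cos_bd by (intro continuous_on_tendsto_compose[OF continuous_on_arccos' cos_u]
      continuous_on_tendsto_compose[OF continuous_on_arccos' cos_l]; auto)+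
  then have arc: "(\<lambda>i. arccos (cosine (u i))) \<longlonglongrightarrow> 0" "(\<lambda>i. pi - arccos (cosine (l i))) \<longlonglongrightarrow> 0"
    using tendsto_diff[OF tendsto_const[of pi], of "\<lambda>i. arccos (cosine (l i))" pi sequentially] by simp_all
  \<comment> \<open>At a finite end of \<open>active\<close> the weight does not tend to 0;
    boundedness suffices because the sector areas do.\<close>
  have bdd: "(\<lambda>i. weight (w i) * g i) \<longlonglongrightarrow> 0" if "g \<longlonglongrightarrow> 0" for w g
  proof (rule Lim_null_comparison[OF always_eventually])
    show "\<forall>i. norm (weight (w i) * g i) \<le> norm (g i)"
      using weight_bounds by (simp add: abs_mult mult_left_le_one_le less_imp_le)
    show "(\<lambda>i. norm (g i)) \<longlonglongrightarrow> 0" using that by (rule tendsto_norm_zero)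
  qed
  have "(\<lambda>i. mean_weight (l i) (u i)) \<longlonglongrightarrow> total_weight"
    unfolding mean_weight_def total_weight_def
  proof (rule integral_dominated_convergence[OF _ _ integrable_half_discs])
    show "AE x in lborel. (\<lambda>i. indicator half_discs x * weight (clamp_contact (l i) (u i) x))
      \<longlonglongrightarrow> indicator half_discs x * weight (contact x)"
    proof (rule AE_I2)
      fix x :: "real \<times> real"
      show "(\<lambda>i. indicator half_discs x * weight (clamp_contact (l i) (u i) x))
        \<longlonglongrightarrow> indicator half_discs x * weight (contact x)"
      proof (cases "x \<in> half_discs")
        case True
        \<comment> \<open>For fixed \<open>x\<close> the clamp is eventually inactive, so the
          sequence is eventually constant.\<close>
        from ev[OF contact_active[OF True]]
        have "\<forall>\<^sub>F i in sequentially. indicator half_discs x * weight (clamp_contact (l i) (u i) x) =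
            indicator half_discs x * weight (contact x)"
          by eventually_elim (simp add: min_absorb2 max_absorb2)
        then show ?thesis by (rule tendsto_eventually)
      qed simp
    qed
    show "AE x in lborel. norm (indicator half_discs x * weight (clamp_contact (l i) (u i) x))
        \<le> indicator half_discs x" for i
      using weight_bounds by (intro AE_I2) (auto simp: indicator_def less_imp_le)
  qed (use borel_weight_contact in simp_all)
  from tendsto_diff[OF tendsto_diff[OF this bdd[OF arc(1)]] bdd[OF arc(2)]]
  have lim: "(\<lambda>i. LINT p:{l i..u i}|lborel. arc_density p) \<longlonglongrightarrow> total_weight"
    using integral_arc_density(2)[OF less_imp_le[OF approx(4)] sub] by simp
  note [measurable] = f(1)
  have AE_f: "AE p in lborel. indicator S p *\<^sub>R arc_density p = indicator S p *\<^sub>R f p" for S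
    using f(2) by eventually_elim simp
  have eq: "(LINT p:{l i..u i}|lborel. f p) = (LINT p:{l i..u i}|lborel. arc_density p)" for i
    unfolding set_lebesgue_integral_def by (rule integral_cong_AE[symmetric, OF _ _ AE_f]) measurable
  have int: "set_integrable lborel {l i..u i} f" for i
    using integral_arc_density(1)[OF less_imp_le[OF approx(4)] sub, of i] unfolding set_integrable_def
    by (rule integrable_cong_AE_imp[OF _ _ AE_f]) measurable
  have nonneg: "AE p in lborel. a < ereal p \<longrightarrow> ereal p < b \<longrightarrow> 0 \<le> f p"
    using f(2) by eventually_elim (simp add: arc_density_nonneg)
  have meas: "set_borel_measurable lborel (einterval a b) f"
    unfolding set_borel_measurable_def unfolding ab(2) using open_active
    by (intro borel_measurable_scaleR borel_measurable_indicator) (simp_all add: f(1))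
  have "(\<lambda>i. LBINT p=l i..u i. f p) \<longlonglongrightarrow> total_weight"
    using lim eq by (simp add: interval_integral_Icc less_imp_le[OF approx(4)])
  with approx show "set_integrable lborel (einterval a b) f" "(LBINT p=a..b. f p) = total_weight"
    using interval_integral_Icc_approx_nonneg[OF ab(1) approx int nonneg meas] by blast+
qed

lemma AE_half_discs: "AE x in lborel. x \<in> unit_disc \<longleftrightarrow> x \<in> half_discs"
proof -
  have "AE x :: real \<times> real in lebesgue. x \<notin> sphere 0 1"
    by (intro AE_not_in) (simp flip: negligible_iff_null_sets add: negligible_sphere)
  then have "AE x :: real \<times> real in lborel. x \<notin> sphere 0 1"
    by (simp add: AE_completion_iff)
  with AE_snd_nonzero show ?thesis
  proof eventually_elim
    case (elim x)
    have "x \<in> unit_disc \<longleftrightarrow> x \<in> open_disc"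
      using elim(2) by (auto simp: unit_disc_eq_cball open_disc_eq_ball)
    also have "\<dots> \<longleftrightarrow> x \<in> half_discs" using elim(1) by (simp add: open_disc_def half_discs_def)
    finally show ?case .
  qed
qed

text \<open>The gradient is an arbitrary choice where no derivative exists, so measurability of
  \<open>F\<close> on the disc is obtained from its a.e. equality with the Borel function
  \<open>?w\<close> and the completeness of Lebesgue measure.\<close>

lemma integral_disc:
  fixes F :: "real \<times> real \<Rightarrow> real"
  assumes F: "\<And>x. F x = 1 / (1 + (norm (gradient profile_fun x))\<^sup>2)"
  shows "set_integrable lebesgue unit_disc F" "(LINT x:unit_disc|lebesgue. F x) = total_weight"
proof -
  let ?w = "\<lambda>x. indicator half_discs x * weight (contact x)"
  have "AE x in lborel. ?w x = indicator unit_disc x *\<^sub>R F x"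
    using AE_half_discs
  proof eventually_elim
    case (elim x)
    then show ?case
      using norm_gradient_profile_fun[of x] by (cases "x \<in> half_discs") (simp_all add: F weight_def)
  qed
  then have AE: "AE x in lebesgue. ?w x = indicator unit_disc x *\<^sub>R F x"
    by (rule AE_completion)
  have w: "integrable lebesgue ?w"
    using integrable_weight_contact by (simp add: integrable_completion borel_weight_contact)
  have meas: "(\<lambda>x. indicator unit_disc x *\<^sub>R F x) \<in> borel_measurable lebesgue"
    using borel_measurable_AE[OF borel_measurable_integrable[OF w] AE] .
  show "set_integrable lebesgue unit_disc F"
    unfolding set_integrable_def by (rule integrable_cong_AE_imp[OF w meas AE])
  have "(LINT x:unit_disc|lebesgue. F x) = integral\<^sup>L lebesgue ?w"
    unfolding set_lebesgue_integral_def
    by (intro integral_cong_AE meas borel_measurable_integrable[OF w]) (use AE in \<open>auto elim: eventually_mono\<close>)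
  also have "\<dots> = total_weight"
    unfolding total_weight_def by (rule integral_completion) (simp add: borel_weight_contact)
  finally show "(LINT x:unit_disc|lebesgue. F x) = total_weight" .
qed

lemma countable_not_isCont_slope: "countable {p. \<not> isCont slope p}"
  using conv by (intro mono_ctble_discont mono_right_slope)

lemma deriv_v: "isCont slope p \<Longrightarrow> deriv v p = slope p"
  using DERIV_if_isCont_right_slope[OF conv] by (intro DERIV_imp_deriv)

end

theorem theorem3:
  fixes \<Omega> :: "(real \<times> real) set"
    and M :: real
    and v :: "real \<Rightarrow> real"
    and u :: "real \<times> real \<Rightarrow> ereal"
    and p0m p0p :: ereal
    and F :: "real \<times> real \<Rightarrow> real"
    and G :: "real \<Rightarrow> real"
  assumes "\<Omega> = {(x1, x2). x1\<^sup>2 + x2\<^sup>2 \<le> 1}"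
    and "M > 0"
    and "convex_on UNIV v"
    and "\<And>p. \<bar>p\<bar> \<le> v p"
    and "\<And>p. v p \<le> \<bar>p\<bar> + M"
    and "v 0 > 0"
    and "u = conv_fun (indicator_fun \<Omega>) (extend_to_plane (conjugate_fun v))"
    and "p0m = (INF p \<in> {p. v p > - p}. ereal p)"
    and "p0p = (SUP p \<in> {p. v p > p}. ereal p)"
    and "\<And>x. F x = 1 / (1 + (norm (gradient (\<lambda>y. real_of_ereal (u y)) x))\<^sup>2)"
    and "\<And>p. G p = 2 * sqrt ((v p)\<^sup>2 - p\<^sup>2) * (deriv v p)\<^sup>2 / (1 + (v p)\<^sup>2)\<^sup>2
           - (p * deriv v p - v p) / (v p * (1 + (v p)\<^sup>2) * sqrt ((v p)\<^sup>2 - p\<^sup>2))"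
  shows "eff_dom u = \<Omega> \<and>
         set_integrable lebesgue \<Omega> F \<and>
         interval_lebesgue_integrable lborel p0m p0p G \<and>
         (LINT x:\<Omega>|lebesgue. F x) = (LBINT p=p0m..p0p. G p)"
proof -
  interpret profile v M
    using assms by unfold_locales auto
  have \<Omega>: "\<Omega> = unit_disc" by (auto simp: assms(1) unit_disc_def)
  have u: "u = hull_fun" by (simp add: assms(7) hull_fun_def \<Omega>)
  have I: "einterval p0m p0p = active" unfolding assms(8,9) by (rule einterval_active)
  have less: "p0m < p0p"
    using zero_active unfolding I[symmetric] einterval_iff by (elim conjE) (rule less_trans)
  have G_eq: "arc_density p = G p" if "isCont slope p" for p
    using deriv_v[OF that] by (simp add: arc_density_def assms(11))
  \<comment> \<open>\<open>deriv v\<close> is unspecified at kinks, but they are among the countably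
    many discontinuities of \<open>slope\<close>; changing a Borel function on a countable set keeps
    it Borel.\<close>
  have "G \<in> borel_measurable borel"
    by (rule measurable_discrete_difference[OF borel_arc_density countable_not_isCont_slope]) (auto simp: G_eq)
  moreover have "AE p in lborel. p \<notin> {p. \<not> isCont slope p}"
    using countable_not_isCont_slope by (intro AE_not_in countable_imp_null_set_lborel)
  then have "AE p in lborel. G p = arc_density p"
    by eventually_elim (simp add: G_eq)
  ultimately have "set_integrable lborel (einterval p0m p0p) G" "(LBINT p=p0m..p0p. G p) = total_weight"
    using integral_arc_density_active[OF less I] by auto
  moreover have "set_integrable lebesgue unit_disc F" "(LINT x:unit_disc|lebesgue. F x) = total_weight"
    using integral_disc[of F] assms(10) by (simp_all add: u)
  ultimately show ?thesis
    using less eff_dom_hull_fun by (simp add: \<Omega> u interval_lebesgue_integrable_def less_imp_le)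
qed

end
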